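(* For each integer $n\geq 5$, the right-angled Artin group $A(\overline{C}_n)$, where $\overline{C}_n$ denotes the complement graph of an $n$-cycle, contains a hyperbolic surface subgroup; that is, it has a subgroup isomorphic to the fundamental group of a closed orientable surface with negative Euler characteristic.
   Context: All graphs are finite and simple. For a graph $\Gamma$ with vertex set $V_\Gamma$ and edge set $E_\Gamma$, the right-angled Artin group with defining graph $\Gamma$ is $$A(\Gamma)=\langle V_\Gamma \ ;\ vwv^{-1}w^{-1}=1 \text{ for all } \{v,w\}\in E_\Gamma\rangle.$$ The $n$-cycle $C_n$ is the underlying graph of a regular $n$-gon. The complement graph $\overline{\Gamma}$ has the same vertices as $\Gamma$, and two distinct vertices are adjacent in $\overline{\Gamma}$ if and only if they are not adjacent in $\Gamma$. A hyperbolic surface group is the fundamental group of a closed orientable (connected) surface with negative Euler characteristic. *)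

theory Defs
  imports "HOL-Analysis.Analysis" "HOL-Algebra.Group"
begin

section \<open>Groups given by generators and relators\<close>

text \<open>A letter \<open>(x, True)\<close> stands for the generator \<open>x\<close>, and \<open>(x, False)\<close> for its inverse.\<close>

type_synonym 'a word = "('a \<times> bool) list"

definition words_over :: "'a set \<Rightarrow> 'a word set"
  where "words_over X = lists (X \<times> UNIV)"

inductive pres_eq :: "'a set \<Rightarrow> 'a word set \<Rightarrow> 'a word \<Rightarrow> 'a word \<Rightarrow> bool"
  for X :: "'a set" and R :: "'a word set"
  where
    refl: "pres_eq X R u u"
  | sym: "pres_eq X R u v \<Longrightarrow> pres_eq X R v u"
  | trans: "pres_eq X R u v \<Longrightarrow> pres_eq X R v w \<Longrightarrow> pres_eq X R u w"
  | cancel: "x \<in> X \<Longrightarrow> pres_eq X R (u @ [(x, b), (x, \<not> b)] @ v) (u @ v)"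
  | relator: "r \<in> R \<Longrightarrow> pres_eq X R (u @ r @ v) (u @ v)"

definition pres_class :: "'a set \<Rightarrow> 'a word set \<Rightarrow> 'a word \<Rightarrow> 'a word set"
  where "pres_class X R u = {v. pres_eq X R u v}"

definition presented_group :: "'a set \<Rightarrow> 'a word set \<Rightarrow> 'a word set monoid"
  where "presented_group X R =
    \<lparr> carrier = pres_class X R ` words_over X,
      mult = (\<lambda>A B. \<Union>u\<in>A. \<Union>v\<in>B. pres_class X R (u @ v)),
      one = pres_class X R [] \<rparr>"

lemma pres_eq_append:
  assumes "pres_eq X R u u'" "pres_eq X R v v'"
  shows "pres_eq X R (u @ v) (u' @ v')"
proof -
  have left: "pres_eq X R (s @ a) (s @ b)" if "pres_eq X R a b" for a b s
    using that
  proof (induction rule: pres_eq.induct)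
    case (cancel x p b q)
    then show ?case using pres_eq.cancel[of x X R "s @ p" b q] by simp
  next
    case (relator r p q)
    then show ?case using pres_eq.relator[of r R X "s @ p" q] by simp
  qed (blast intro: pres_eq.intros)+
  have right: "pres_eq X R (a @ s) (b @ s)" if "pres_eq X R a b" for a b s
    using that
  proof (induction rule: pres_eq.induct)
    case (cancel x p b q)
    then show ?case using pres_eq.cancel[of x X R p b "q @ s"] by simp
  next
    case (relator r p q)
    then show ?case using pres_eq.relator[of r R X p "q @ s"] by simp
  qed (blast intro: pres_eq.intros)+
  show ?thesis
    using left right assms pres_eq.trans by metis
qed

lemma pres_class_eq_iff: "pres_class X R u = pres_class X R v \<longleftrightarrow> pres_eq X R u v"
  unfolding pres_class_def by (blast intro: pres_eq.intros)

lemma presented_group_mult: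
  "pres_class X R u \<otimes>\<^bsub>presented_group X R\<^esub> pres_class X R v = pres_class X R (u @ v)"
proof -
  have "pres_class X R (u' @ v') = pres_class X R (u @ v)"
    if "u' \<in> pres_class X R u" "v' \<in> pres_class X R v" for u' v'
    using that unfolding pres_class_eq_iff
    by (auto simp: pres_class_def intro: pres_eq_append pres_eq.sym)
  moreover have "u \<in> pres_class X R u" "v \<in> pres_class X R v"
    by (auto simp: pres_class_def pres_eq.refl)
  ultimately show ?thesis
    unfolding presented_group_def monoid.simps by blast
qed

lemma pres_eq_inverse:
  assumes "w \<in> words_over X"
  shows "pres_eq X R (rev (map (apsnd Not) w) @ w) []"
  using assms
proof (induction w)
  case Nil
  show ?case by (simp add: pres_eq.refl)
next
  case (Cons l w)
  obtain x b where l: "l = (x, b)" by force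
  have x: "x \<in> X" and w: "w \<in> words_over X"
    using Cons.prems by (auto simp: words_over_def l)
  have "pres_eq X R (rev (map (apsnd Not) w) @ [(x, \<not> b), (x, \<not> \<not> b)] @ w)
      (rev (map (apsnd Not) w) @ w)"
    by (rule pres_eq.cancel[OF x])
  then show ?case
    using Cons.IH[OF w] by (auto simp: l intro: pres_eq.trans)
qed

lemma group_presented_group: "group (presented_group X R)"
proof (rule groupI)
  let ?G = "presented_group X R"
  have carrier: "carrier ?G = pres_class X R ` words_over X"
    and one: "\<one>\<^bsub>?G\<^esub> = pres_class X R []"
    by (simp_all add: presented_group_def)
  show "\<one>\<^bsub>?G\<^esub> \<in> carrier ?G"
    by (auto simp: carrier one words_over_def)
  show "a \<otimes>\<^bsub>?G\<^esub> b \<in> carrier ?G" if "a \<in> carrier ?G" "b \<in> carrier ?G" for a b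
    using that by (fastforce simp: carrier presented_group_mult words_over_def simp del: in_lists_conv_set)
  show "a \<otimes>\<^bsub>?G\<^esub> b \<otimes>\<^bsub>?G\<^esub> c = a \<otimes>\<^bsub>?G\<^esub> (b \<otimes>\<^bsub>?G\<^esub> c)"
    if "a \<in> carrier ?G" "b \<in> carrier ?G" "c \<in> carrier ?G" for a b c
    using that by (auto simp: carrier presented_group_mult)
  show "\<one>\<^bsub>?G\<^esub> \<otimes>\<^bsub>?G\<^esub> a = a" if "a \<in> carrier ?G" for a
    using that by (auto simp: carrier one presented_group_mult)
  show "\<exists>b\<in>carrier ?G. b \<otimes>\<^bsub>?G\<^esub> a = \<one>\<^bsub>?G\<^esub>" if "a \<in> carrier ?G" for a
  proof -
    obtain w where w: "w \<in> words_over X" "a = pres_class X R w"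
      using \<open>a \<in> carrier ?G\<close> by (auto simp: carrier)
    have "rev (map (apsnd Not) w) \<in> words_over X"
      using w(1) by (fastforce simp: words_over_def)
    then show ?thesis
      using pres_eq_inverse[OF w(1)]
      by (auto simp: carrier one w(2) presented_group_mult pres_class_eq_iff)
  qed
qed


section \<open>Right-angled Artin groups, cycles and complement graphs\<close>

text \<open>A simple graph is given by its vertex set and its set of two-element edges.\<close>

definition raag :: "'a set \<Rightarrow> 'a set set \<Rightarrow> 'a word set monoid"
  where "raag V E =
    presented_group V {[(v, True), (w, True), (v, False), (w, False)] | v w. {v, w} \<in> E}"

definition complement_edges :: "'a set \<Rightarrow> 'a set set \<Rightarrow> 'a set set"
  where "complement_edges V E = {{v, w} | v w. v \<in> V \<and> w \<in> V \<and> v \<noteq> w \<and> {v, w} \<notin> E}"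

text \<open>The \<open>n\<close>-cycle has vertex set \<open>{..<n}\<close>; the definition is meant for \<open>n \<ge> 3\<close>.\<close>

definition cycle_edges :: "nat \<Rightarrow> nat set set"
  where "cycle_edges n = {{i, Suc i mod n} | i. i < n}"


section \<open>The fundamental group\<close>

definition loops_at :: "'a::topological_space set \<Rightarrow> 'a \<Rightarrow> (real \<Rightarrow> 'a) set"
  where "loops_at S x =
    {p. path p \<and> path_image p \<subseteq> S \<and> pathstart p = x \<and> pathfinish p = x}"

definition path_class :: "'a::topological_space set \<Rightarrow> (real \<Rightarrow> 'a) \<Rightarrow> (real \<Rightarrow> 'a) set"
  where "path_class S p = {q. homotopic_paths S p q}"

definition fundamental_group :: "'a::topological_space set \<Rightarrow> 'a \<Rightarrow> (real \<Rightarrow> 'a) set monoid"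
  where "fundamental_group S x =
    \<lparr> carrier = path_class S ` loops_at S x,
      mult = (\<lambda>A B. \<Union>p\<in>A. \<Union>q\<in>B. path_class S (p +++ q)),
      one = path_class S (\<lambda>_. x) \<rparr>"

lemma homotopic_paths_const_join:
  assumes "p \<in> loops_at S x"
  shows "homotopic_paths S ((\<lambda>_. x) +++ p) p"
proof -
  have cont: "continuous_on {0..1} (\<lambda>t::real. max 0 (2 * t - 1))"
    by (intro continuous_intros)
  have "((\<lambda>_. x) +++ p) t = p (max 0 (2 * t - 1))" for t
    using assms by (cases "2 * t \<le> 1") (auto simp: loops_at_def joinpaths_def pathstart_def)
  then have "homotopic_paths S p ((\<lambda>_. x) +++ p)"
    using assms by (intro homotopic_paths_reparametrize[OF _ _ cont]) (auto simp: loops_at_def)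
  then show ?thesis
    by (rule homotopic_paths_sym)
qed

lemma homotopic_paths_join_reversepath:
  assumes "p \<in> loops_at S x"
  shows "homotopic_paths S (p +++ reversepath p) (\<lambda>_. x)"
proof -
  have p: "continuous_on {0..1} p" "p ` {0..1} \<subseteq> S" "p 0 = x" "p 1 = x"
    using assms by (auto simp: loops_at_def path_defs)
  define f where "f = (\<lambda>y::real \<times> real. fst y * (1 - \<bar>2 * snd y - 1\<bar>))"
  have f: "f \<in> {0..1} \<times> {0..1} \<rightarrow> {0..1}"
    by (auto simp: f_def intro!: mult_nonneg_nonneg mult_le_one)
  have contf: "continuous_on ({0..1} \<times> {0..1}) f"
    unfolding f_def by (intro continuous_intros)
  have "continuous_on ({0..1} \<times> {0..1}) (\<lambda>y. p (f y))"
    using f by (intro continuous_on_compose2[OF p(1) contf]) auto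
  moreover have "(\<lambda>y. p (f y)) \<in> {0..1} \<times> {0..1} \<rightarrow> S"
    using f p(2) by (fastforce simp: image_subset_iff)
  moreover have "p (f (1, t)) = (p +++ reversepath p) t" for t
    by (auto simp: f_def joinpaths_def reversepath_def abs_if algebra_simps)
  ultimately have "homotopic_paths S (\<lambda>_. x) (p +++ reversepath p)"
    unfolding homotopic_paths using p(3,4)
    by (intro exI[of _ "\<lambda>y. p (f y)"])
      (auto simp: f_def path_defs joinpaths_def reversepath_def)
  then show ?thesis
    by (rule homotopic_paths_sym)
qed

lemma path_class_eq_iff:
  assumes "p \<in> loops_at S x"
  shows "path_class S p = path_class S q \<longleftrightarrow> homotopic_paths S p q"
proof
  assume eq: "path_class S p = path_class S q"
  have "p \<in> path_class S p"
    using assms by (auto simp: path_class_def loops_at_def)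
  then show "homotopic_paths S p q"
    using eq by (auto simp: path_class_def intro: homotopic_paths_sym)
qed (use homotopic_paths_sym homotopic_paths_trans in \<open>unfold path_class_def, blast\<close>)

lemma loops_at_join: "p \<in> loops_at S x \<Longrightarrow> q \<in> loops_at S x \<Longrightarrow> p +++ q \<in> loops_at S x"
  by (auto simp: loops_at_def path_image_join)

lemma fundamental_group_mult:
  assumes "p \<in> loops_at S x" "q \<in> loops_at S x"
  shows "path_class S p \<otimes>\<^bsub>fundamental_group S x\<^esub> path_class S q = path_class S (p +++ q)"
proof -
  have "path_class S (p' +++ q') = path_class S (p +++ q)"
    if "p' \<in> path_class S p" "q' \<in> path_class S q" for p' q'
  proof -
    have "homotopic_paths S (p +++ q) (p' +++ q')"
      using that assms by (intro homotopic_paths_join) (auto simp: path_class_def loops_at_def)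
    then show ?thesis
      using path_class_eq_iff[OF loops_at_join[OF assms]] by metis
  qed
  moreover have "p \<in> path_class S p" "q \<in> path_class S q"
    using assms by (auto simp: path_class_def loops_at_def)
  ultimately show ?thesis
    unfolding fundamental_group_def monoid.simps by blast
qed

lemma group_fundamental_group:
  assumes "x \<in> S"
  shows "group (fundamental_group S x)"
proof (rule groupI)
  let ?G = "fundamental_group S x"
  have carrier: "carrier ?G = path_class S ` loops_at S x"
    and one: "\<one>\<^bsub>?G\<^esub> = path_class S (\<lambda>_. x)"
    by (simp_all add: fundamental_group_def)
  have const: "(\<lambda>_. x) \<in> loops_at S x"
    using assms by (auto simp: loops_at_def path_defs)
  show "\<one>\<^bsub>?G\<^esub> \<in> carrier ?G"
    using const by (simp add: carrier one)
  show "a \<otimes>\<^bsub>?G\<^esub> b \<in> carrier ?G" if "a \<in> carrier ?G" "b \<in> carrier ?G" for a b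
    using that by (auto simp: carrier fundamental_group_mult loops_at_join)
  show "a \<otimes>\<^bsub>?G\<^esub> b \<otimes>\<^bsub>?G\<^esub> c = a \<otimes>\<^bsub>?G\<^esub> (b \<otimes>\<^bsub>?G\<^esub> c)"
    if abc: "a \<in> carrier ?G" "b \<in> carrier ?G" "c \<in> carrier ?G" for a b c
  proof -
    obtain p q r where pqr: "p \<in> loops_at S x" "q \<in> loops_at S x" "r \<in> loops_at S x"
      and eqs: "a = path_class S p" "b = path_class S q" "c = path_class S r"
      using abc by (auto simp: carrier)
    have "homotopic_paths S (p +++ (q +++ r)) ((p +++ q) +++ r)"
      using pqr by (intro homotopic_paths_assoc) (auto simp: loops_at_def)
    then have "path_class S (p +++ (q +++ r)) = path_class S ((p +++ q) +++ r)"
      using path_class_eq_iff pqr loops_at_join by metis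
    then show ?thesis
      using pqr by (simp add: eqs fundamental_group_mult loops_at_join)
  qed
  show "\<one>\<^bsub>?G\<^esub> \<otimes>\<^bsub>?G\<^esub> a = a" if "a \<in> carrier ?G" for a
  proof -
    obtain p where p: "p \<in> loops_at S x" "a = path_class S p"
      using \<open>a \<in> carrier ?G\<close> by (auto simp: carrier)
    then show ?thesis
      using homotopic_paths_const_join[OF p(1)] path_class_eq_iff[OF loops_at_join[OF const p(1)]]
      by (simp add: one fundamental_group_mult const)
  qed
  show "\<exists>b\<in>carrier ?G. b \<otimes>\<^bsub>?G\<^esub> a = \<one>\<^bsub>?G\<^esub>" if "a \<in> carrier ?G" for a
  proof -
    obtain p where p: "p \<in> loops_at S x" "a = path_class S p"
      using \<open>a \<in> carrier ?G\<close> by (auto simp: carrier)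
    have r: "reversepath p \<in> loops_at S x"
      using p(1) by (auto simp: loops_at_def)
    have "path_class S (reversepath p +++ p) = path_class S (\<lambda>_. x)"
      using homotopic_paths_join_reversepath[OF r] path_class_eq_iff[OF loops_at_join[OF r p(1)]]
      by simp
    then show ?thesis
      using p r by (auto simp: carrier one fundamental_group_mult)
  qed
qed


section \<open>Closed orientable surfaces\<close>

definition closed_surface :: "'a::t2_space set \<Rightarrow> bool"
  where "closed_surface S \<longleftrightarrow>
    S \<noteq> {} \<and> compact S \<and> connected S \<and>
    (\<forall>x\<in>S. \<exists>U. openin (top_of_set S) U \<and> x \<in> U \<and> U homeomorphic (UNIV :: (real^2) set))"

text \<open>
  Orientability and the Euler characteristic are read off a finite triangulation. Simplices are
  finite nonempty sets of natural numbers. The realization consists of the tuples of barycentric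
  coordinates supported on a simplex; as the complex is finite, the product topology on
  \<open>nat \<Rightarrow> real\<close> induces the usual topology on it.
\<close>

definition finite_simplicial_complex :: "nat set set \<Rightarrow> bool"
  where "finite_simplicial_complex K \<longleftrightarrow>
    finite K \<and> (\<forall>\<sigma>\<in>K. finite \<sigma> \<and> \<sigma> \<noteq> {} \<and> (\<forall>\<tau>. \<tau> \<subseteq> \<sigma> \<and> \<tau> \<noteq> {} \<longrightarrow> \<tau> \<in> K))"

definition realization :: "nat set set \<Rightarrow> (nat \<Rightarrow> real) set"
  where "realization K =
    {t. (\<forall>i. 0 \<le> t i) \<and> {i. t i \<noteq> 0} \<in> K \<and> (\<Sum>i | t i \<noteq> 0. t i) = 1}"

definition triangulates :: "nat set set \<Rightarrow> 'a::topological_space set \<Rightarrow> bool"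
  where "triangulates K S \<longleftrightarrow> finite_simplicial_complex K \<and> realization K homeomorphic S"

text \<open>
  An orientation of a triangle is one of the two ways to direct its boundary as a cycle, recorded
  by its set of directed edges. A choice \<open>D\<close> of orientations is coherent if triangles sharing an
  edge direct that edge oppositely.
\<close>

definition coherently_orientable :: "nat set set \<Rightarrow> bool"
  where "coherently_orientable K \<longleftrightarrow>
    (\<exists>D :: nat set \<Rightarrow> (nat \<times> nat) set.
      (\<forall>\<sigma>\<in>K. card \<sigma> = 3 \<longrightarrow>
        (\<exists>a b c. \<sigma> = {a, b, c} \<and> D \<sigma> = {(a, b), (b, c), (c, a)})) \<and>
      (\<forall>\<sigma>\<in>K. \<forall>\<tau>\<in>K. card \<sigma> = 3 \<and> card \<tau> = 3 \<and> \<sigma> \<noteq> \<tau> \<longrightarrow> D \<sigma> \<inter> D \<tau> = {}))"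

definition orientable_surface :: "'a::t2_space set \<Rightarrow> bool"
  where "orientable_surface S \<longleftrightarrow>
    closed_surface S \<and> (\<exists>K. triangulates K S \<and> coherently_orientable K)"

text \<open>
  The Euler characteristic is a relation, since its independence of the triangulation is a theorem.
\<close>

definition has_euler_characteristic :: "'a::topological_space set \<Rightarrow> int \<Rightarrow> bool"
  where "has_euler_characteristic S k \<longleftrightarrow>
    (\<exists>K. triangulates K S \<and> k = (\<Sum>\<sigma>\<in>K. (- 1) ^ (card \<sigma> - 1)))"

text \<open>
  Every closed surface is homeomorphic to the realization of a finite simplicial complex, hence to
  a subset of \<open>nat \<Rightarrow> real\<close>; restricting \<open>S\<close> to such subsets loses no isomorphism type of groups.
\<close>

definition hyperbolic_surface_group :: "('g, 'm) monoid_scheme \<Rightarrow> bool"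
  where "hyperbolic_surface_group G \<longleftrightarrow>
    (\<exists>(S :: (nat \<Rightarrow> real) set) x k.
      orientable_surface S \<and> has_euler_characteristic S k \<and> k < 0 \<and>
      x \<in> S \<and> G \<cong> fundamental_group S x)"

end

theory Submission
  imports Defs "HOL-Library.Nat_Bijection"
begin

text \<open>
  Let \<open>W\<close> be the right-angled Coxeter group of the pentagon: it has generators \<open>s\<^sub>0, \<dots>, s\<^sub>4\<close>, all
  of order two, and cyclically consecutive ones commute. The squares of the 5-cube in consecutive
  directions form a closed orientable surface with 32 corners, 80 edges and 40 squares, hence of
  Euler characteristic \<open>- 8\<close> (Droms, Servatius and Servatius). An edge path in it is a word in the
  directions, and homotopies of edge paths are the relations of \<open>W\<close>. So the fundamental group of
  the surface is the group of those elements of \<open>W\<close> whose words close up.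

  Label each edge in direction \<open>k\<close> by an element \<open>a\<^sub>k\<close> of the Artin group, with a sign according to
  its direction in the cube. If \<open>a\<^sub>k\<close> and \<open>a\<^sub>k\<^sub>+\<^sub>1\<close> commute, this defines a homomorphism from the
  surface group. For \<open>n = 5\<close> the pentagon is its own complement and the \<open>a\<^sub>k\<close> are the generators. For
  larger \<open>n\<close> one contracts the path \<open>4, \<dots>, n - 1\<close> of the cycle to a single vertex, following Kim's
  co-contraction, and represents this vertex by the conjugate of the generator \<open>4\<close> by the product
  of the generators \<open>n - 1, \<dots>, 5\<close>. The labels still commute (\<open>raag_word_weq\<close>).

  Injectivity needs no normal forms. For \<open>n = 5\<close> the assignment \<open>a\<^sub>k \<mapsto> s\<^sub>k\<close> defines a homomorphism
  from the Artin group to \<open>W\<close>, and its composition with the labelling is the inclusion of the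
  surface group into \<open>W\<close>. For larger \<open>n\<close> the same works with the wreath product of \<open>W\<close> and a
  symmetric group: the generators \<open>5, \<dots>, n - 1\<close> permute positions, and a label \<open>a\<^sub>k\<close> acts at
  position \<open>0\<close> as \<open>s\<^sub>k\<close> (\<open>raag_word_faithful\<close>).

  It remains to connect loops with words. The open stars of the corners cover the surface. A loop
  runs through finitely many stars, and their corners spell a word. Independence of the choices and
  homotopy invariance (\<open>traces_unique\<close>, \<open>traces_homotopic\<close>) follow from a cocycle condition on
  triple intersections of stars, since corners whose stars meet lie on a common square. As stars
  are discs and squares are convex, the loop is homotopic to the edge path of its word
  (\<open>traces_homotopic_epath\<close>), and equivalent words have homotopic edge paths (\<open>epath_weq\<close>). Cutting
  the squares along diagonals triangulates the surface, which gives the Euler characteristic and the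
  orientability in the combinatorial form required.
\<close>

section \<open>Words of directions\<close>

text \<open>
  The five directions \<open>0, \<dots>, 4\<close> of the 5-cube are arranged in a cyclic order, and the surface
  contains the squares spanned by two cyclically consecutive directions.
\<close>

definition adj :: "nat \<Rightarrow> nat \<Rightarrow> bool"
  where "adj i j \<longleftrightarrow> i < 5 \<and> j < 5 \<and> (j = Suc i mod 5 \<or> i = Suc j mod 5)"

lemma less_five: "(i::nat) < 5 \<longleftrightarrow> i = 0 \<or> i = 1 \<or> i = 2 \<or> i = 3 \<or> i = 4"
  by auto

lemma adj_iff:
  "adj i j \<longleftrightarrow> (i, j) \<in> {(0, 1), (1, 0), (1, 2), (2, 1), (2, 3), (3, 2), (3, 4), (4, 3), (4, 0), (0, 4)}"
proof (cases "i < 5 \<and> j < 5")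
  case True
  then have "i = 0 \<or> i = 1 \<or> i = 2 \<or> i = 3 \<or> i = 4" "j = 0 \<or> j = 1 \<or> j = 2 \<or> j = 3 \<or> j = 4"
    by (simp_all only: less_five)
  then show ?thesis
    by (elim disjE) (simp_all add: adj_def)
qed (auto simp: adj_def)

lemma adj_irrefl: "adj i j \<Longrightarrow> i \<noteq> j"
  by (auto simp: adj_iff)

lemma adj_sym: "adj i j \<Longrightarrow> adj j i"
  unfolding adj_def by blast

lemma adj_less: "adj i j \<Longrightarrow> i < 5" "adj i j \<Longrightarrow> j < 5"
  unfolding adj_def by blast+

text \<open>
  The relation \<open>\<doteq>\<close> presents the right-angled Coxeter group of the pentagon: generators are
  involutions, and neighbouring generators commute. Both kinds of moves are geometric, as
  \<open>cancel\<close> removes a backtracking of an edge path and \<open>swap\<close> pushes it across a square. Keeping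
  words instead of group elements means that the word problem never has to be solved.
\<close>

inductive weq :: "nat list \<Rightarrow> nat list \<Rightarrow> bool" (infix "\<doteq>" 50)
  where
    refl: "w \<doteq> w"
  | sym: "v \<doteq> w \<Longrightarrow> w \<doteq> v"
  | trans: "u \<doteq> v \<Longrightarrow> v \<doteq> w \<Longrightarrow> u \<doteq> w"
  | Cons: "v \<doteq> w \<Longrightarrow> i # v \<doteq> i # w"
  | cancel: "i < 5 \<Longrightarrow> i # i # w \<doteq> w"
  | swap: "adj i j \<Longrightarrow> i # j # w \<doteq> j # i # w"

declare weq.trans [trans]

lemma weq_append_left: "v \<doteq> w \<Longrightarrow> u @ v \<doteq> u @ w"
  by (induction u) (auto intro: weq.Cons)

lemma weq_append_right: "v \<doteq> w \<Longrightarrow> v @ u \<doteq> w @ u"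
  by (induction rule: weq.induct) (auto intro: weq.intros)

text \<open>
  A set of directions is a corner of the cube; \<open>flip i\<close> crosses the edge in direction \<open>i\<close>.
\<close>

definition flip :: "nat \<Rightarrow> nat set \<Rightarrow> nat set"
  where "flip i u = (if i \<in> u then u - {i} else insert i u)"

lemma flip_flip [simp]: "flip i (flip i u) = u"
  by (auto simp: flip_def)

lemma flip_commute: "flip i (flip j u) = flip j (flip i u)"
  by (auto simp: flip_def)

lemma flip_mem_iff: "k \<in> flip i u \<longleftrightarrow> (if k = i then k \<notin> u else k \<in> u)"
  by (auto simp: flip_def)

section \<open>An action of the Artin group on words\<close>

abbreviation anticycle_relators :: "nat \<Rightarrow> nat word set"
  where "anticycle_relators n \<equiv>
    {[(v, True), (w, True), (v, False), (w, False)] | v w.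
      {v, w} \<in> complement_edges {..<n} (cycle_edges n)}"

text \<open>
  Let \<open>W\<close> be the Coxeter group above. The action defined next is a homomorphism from the Artin
  group of the complement of \<open>C\<^sub>n\<close> to the wreath product of \<open>W\<close> with permutations of the
  positions \<open>0, \<dots>, n - 5\<close>: a state is a word together with a position.
\<close>

definition weq_at :: "nat list \<times> nat \<Rightarrow> nat list \<times> nat \<Rightarrow> bool"
  where "weq_at s t \<longleftrightarrow> fst s \<doteq> fst t \<and> snd s = snd t"

text \<open>
  The vertices \<open>4, \<dots>, n - 1\<close> form a path in \<open>C\<^sub>n\<close>, and contracting it leaves a pentagon. The
  vertices \<open>5, \<dots>, n - 1\<close> act by the adjacent transpositions of the positions, which commute
  exactly when they are not consecutive. The others prepend a generator of \<open>W\<close>: a vertex that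
  commutes with all of \<open>5, \<dots>, n - 1\<close> does so at every position, while \<open>0\<close>, which does not commute
  with \<open>n - 1\<close>, acts only at position \<open>0\<close>, and \<open>4\<close>, which does not commute with \<open>5\<close>, only at the
  last position. Every letter acts as an involution up to \<open>\<doteq>\<close>, so inverse letters act alike.
\<close>

fun letter_act :: "nat \<Rightarrow> nat \<Rightarrow> nat list \<times> nat \<Rightarrow> nat list \<times> nat"
  where "letter_act n v (w, p) =
    (if v = 0 then (if p = 0 then 0 # w else w, p)
     else if v = 1 then (3 # w, p)
     else if v = 2 then (1 # w, p)
     else if v = 3 then (4 # w, p)
     else if v = 4 then (if p = n - 5 then 2 # w else w, p)
     else (w, Transposition.transpose (n - 1 - v) (n - v) p))"

definition word_act :: "nat \<Rightarrow> nat word \<Rightarrow> nat list \<times> nat \<Rightarrow> nat list \<times> nat"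
  where "word_act n u = foldr (\<lambda>l. letter_act n (fst l)) u"

lemma word_act_append: "word_act n (u @ v) s = word_act n u (word_act n v s)"
  by (simp add: word_act_def)

lemma word_act_Nil [simp]: "word_act n [] s = s"
  by (simp add: word_act_def)

lemma word_act_Cons [simp]: "word_act n (l # u) s = letter_act n (fst l) (word_act n u s)"
  by (simp add: word_act_def)

lemma weq_at_trans [trans]: "weq_at s t \<Longrightarrow> weq_at t r \<Longrightarrow> weq_at s r"
  by (auto simp: weq_at_def intro: weq.trans)

lemma letter_act_cong: "weq_at s t \<Longrightarrow> weq_at (letter_act n v s) (letter_act n v t)"
  by (cases s; cases t) (auto simp: weq_at_def intro: weq.Cons)

lemma word_act_cong: "weq_at s t \<Longrightarrow> weq_at (word_act n u s) (word_act n u t)"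
  by (induction u) (auto intro: letter_act_cong)

lemma letter_act_involutive: "weq_at (letter_act n v (letter_act n v s)) s"
  by (cases s) (auto simp: weq_at_def intro: weq.refl weq.cancel)

lemma complement_cycle_edgeD:
  assumes "{v, w} \<in> complement_edges {..<n} (cycle_edges n)"
  shows "v < n" "w < n" "v \<noteq> w" "w \<noteq> Suc v mod n" "v \<noteq> Suc w mod n"
  using assms by (auto simp: complement_edges_def cycle_edges_def doubleton_eq_iff)

lemma complement_cycle_edgeI:
  assumes "v < n" "w < n" "v \<noteq> w" "w \<noteq> Suc v mod n" "v \<noteq> Suc w mod n"
  shows "{v, w} \<in> complement_edges {..<n} (cycle_edges n)"
  using assms unfolding complement_edges_def cycle_edges_def
  by (auto simp: doubleton_eq_iff)

text \<open>
  This is where the combinatorics of the cycle enters. Two non-consecutive vertices either act at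
  disjoint positions, or prepend commuting generators of \<open>W\<close>, or one of them changes only the word
  at all positions alike and the other one only the position.
\<close>

lemma letter_act_commute_less:
  assumes "n \<ge> 5" "v < w" "w < n" "w \<noteq> Suc v" "\<not> (v = 0 \<and> Suc w = n)"
  shows "weq_at (letter_act n v (letter_act n w s)) (letter_act n w (letter_act n v s))"
proof -
  obtain u p where s: "s = (u, p)" by (cases s)
  consider "v = 0" "w = 2" | "v = 0" "w = 3" | "v = 0" "w = 4" | "v = 0" "w \<ge> 5"
    | "v = 1" "w = 3" | "v = 1" "w = 4" | "v = 2" "w = 4"
    | "v = 1" "w \<ge> 5" | "v = 2" "w \<ge> 5" | "v = 3" "w \<ge> 5" | "v = 4" "w > 5" | "v \<ge> 5" "w \<ge> 5"
    using assms by atomize_elim presburger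
  then show ?thesis
  proof cases
    case 3
    then show ?thesis using assms by (simp add: s weq_at_def weq.refl)
  next
    case 4
    then obtain a where "n - w = Suc (Suc a)" "n - 1 - w = Suc a"
      using assms by (intro that[of "n - w - 2"]) auto
    with 4 show ?thesis by (simp add: s weq_at_def Transposition.transpose_def weq.refl)
  next
    case 11
    define a m where "a = n - 1 - w" and "m = n - 5"
    have "n - w = Suc a" "n - Suc w = a" "Suc a < m" using assms 11 by (auto simp: a_def m_def)
    with 11 show ?thesis
      by (simp add: s weq_at_def Transposition.transpose_def weq.refl flip: m_def)
  next
    case 12
    define a b where "a = n - 1 - w" and "b = n - 1 - v"
    have ab: "n - w = Suc a" "n - v = Suc b" "n - Suc w = a" "n - Suc v = b" "Suc a < b"
      using assms 12 by (auto simp: a_def b_def)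
    then have "Transposition.transpose b (Suc b) (Transposition.transpose a (Suc a) p)
             = Transposition.transpose a (Suc a) (Transposition.transpose b (Suc b) p)"
      by (auto simp: Transposition.transpose_def)
    with 12 ab show ?thesis by (simp add: s weq_at_def weq.refl)
  qed (simp_all add: s weq_at_def adj_def weq.refl weq.swap)
qed

lemma letter_act_commute:
  assumes "n \<ge> 5" "{v, w} \<in> complement_edges {..<n} (cycle_edges n)"
  shows "weq_at (letter_act n v (letter_act n w s)) (letter_act n w (letter_act n v s))"
proof -
  note e = complement_cycle_edgeD[OF assms(2)]
  have *: "\<not> (a = 0 \<and> Suc b = n)" "b \<noteq> Suc a" if "b < n" "a < n" "a \<noteq> Suc b mod n" "b \<noteq> Suc a mod n" for a b
    using that by auto
  show ?thesis
  proof (cases "v < w")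
    case True
    then show ?thesis using letter_act_commute_less[of n v w s] * e assms(1) by blast
  next
    case False
    then have "w < v" using e by simp
    then have "weq_at (letter_act n w (letter_act n v s)) (letter_act n v (letter_act n w s))"
      using letter_act_commute_less[of n w v s] * e assms(1) by blast
    then show ?thesis by (auto simp: weq_at_def intro: weq.sym)
  qed
qed

lemma word_act_pres_eq:
  assumes "n \<ge> 5" "pres_eq {..<n} (anticycle_relators n) u v"
  shows "weq_at (word_act n u s) (word_act n v s)"
  using assms(2)
proof (induction arbitrary: s rule: pres_eq.induct)
  case (refl u)
  then show ?case by (simp add: weq_at_def weq.refl)
next
  case (sym u v)
  then show ?case using weq.sym unfolding weq_at_def by metis
next
  case (trans u v w)
  then show ?case using weq_at_trans by blast
next
  case (cancel x u b v)
  then show ?case by (auto simp: word_act_append intro: word_act_cong letter_act_involutive)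
next
  case (relator r u v)
  then obtain a b where r: "r = [(a, True), (b, True), (a, False), (b, False)]"
    and e: "{a, b} \<in> complement_edges {..<n} (cycle_edges n)" by blast
  have "weq_at (letter_act n a (letter_act n b (letter_act n a (letter_act n b t)))) t" for t
  proof -
    have "weq_at (letter_act n a (letter_act n b (letter_act n a (letter_act n b t)))) (letter_act n a (letter_act n b (letter_act n b (letter_act n a t))))"
      by (intro letter_act_cong letter_act_commute assms(1) e)
    also have "weq_at \<dots> (letter_act n a (letter_act n a t))"
      by (intro letter_act_cong letter_act_involutive)
    also have "weq_at \<dots> t"
      by (rule letter_act_involutive)
    finally show ?thesis .
  qed
  from word_act_cong[OF this] show ?case by (simp add: r word_act_append del: letter_act.simps)
qed

section \<open>Labels of edge paths\<close>

text \<open>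
  The generator for the contracted path is the vertex \<open>4\<close> conjugated by the product
  \<open>(n - 1) \<cdots> 6 \<cdot> 5\<close> along the path. In the action this product carries the last position to
  position \<open>0\<close>, so that the conjugate acts at position \<open>0\<close>.
\<close>

definition conjugator :: "nat \<Rightarrow> nat word"
  where "conjugator n = map (\<lambda>v. (v, True)) (rev [5..<n])"

definition conjugator_inv :: "nat \<Rightarrow> nat word"
  where "conjugator_inv n = map (\<lambda>v. (v, False)) [5..<n]"

text \<open>
  Consecutive vertices of the pentagon do not commute, but consecutive directions must. So direction
  \<open>k\<close> is labelled by the pentagon vertex \<open>2 k mod 5\<close>, and direction \<open>2\<close> by the contracted path.
\<close>

definition edge_word :: "nat \<Rightarrow> bool \<Rightarrow> nat \<Rightarrow> nat word"
  where "edge_word n b k =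
    (if k = 2 then conjugator n @ [(4, b)] @ conjugator_inv n
     else [(if k = 0 then 0 else if k = 1 then 2 else if k = 3 then 1 else 3, b)])"

text \<open>
  The product of the labels of an edge path that starts at the corner \<open>u\<close>. An edge in direction
  \<open>k\<close> counts positively when it adds \<open>k\<close> to the corner; so opposite sides of a square carry the
  same label, and the word read around a square is a commutator.
\<close>

fun raag_word :: "nat \<Rightarrow> nat set \<Rightarrow> nat list \<Rightarrow> nat word"
  where
    "raag_word n u [] = []"
  | "raag_word n u (k # w) = edge_word n (k \<notin> u) k @ raag_word n (flip k u) w"

lemma word_act_conjugator_inv:
  assumes "n \<ge> 5"
  shows "word_act n (conjugator_inv n) (w, 0) = (w, n - 5)"
proof -
  have "k \<le> n - 5 \<Longrightarrow> word_act n (map (\<lambda>v. (v, False)) [n - k..<n]) (w, 0) = (w, k)" for k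
  proof (induction k)
    case (Suc k)
    then have "[n - Suc k..<n] = (n - Suc k) # [n - k..<n]"
      by (simp add: upt_rec Suc_diff_Suc)
    with Suc show ?case by (auto simp: Transposition.transpose_def)
  qed simp
  from this[of "n - 5"] assms show ?thesis by (simp add: conjugator_inv_def)
qed

lemma word_act_conjugator:
  assumes "n \<ge> 5"
  shows "word_act n (conjugator n) (w, n - 5) = (w, 0)"
proof -
  have "m \<le> n \<Longrightarrow> m \<ge> 5 \<Longrightarrow> word_act n (map (\<lambda>v. (v, True)) (rev [5..<m])) (w, n - 5) = (w, n - m)" for m
  proof (induction m)
    case (Suc m)
    show ?case
    proof (cases "m = 4")
      case False
      with Suc show ?thesis by (auto simp: Transposition.transpose_def)
    qed simp
  qed simp
  from this[of n] assms show ?thesis by (simp add: conjugator_def)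
qed

lemma word_act_edge_word:
  assumes "n \<ge> 5" "k < 5"
  shows "word_act n (edge_word n b k) (w, 0) = (k # w, 0)"
proof (cases "k = 2")
  case True
  then show ?thesis using assms
    by (simp add: edge_word_def word_act_append word_act_conjugator_inv word_act_conjugator)
next
  case False
  with assms have "k = 0 \<or> k = 1 \<or> k = 3 \<or> k = 4" by auto
  with False show ?thesis by (auto simp: edge_word_def)
qed

text \<open>
  The action undoes the labelling: at position \<open>0\<close>, the label of direction \<open>k\<close> prepends \<open>k\<close>.
\<close>

lemma word_act_raag_word:
  assumes "n \<ge> 5" "set w \<subseteq> {..<5}"
  shows "word_act n (raag_word n u w) ([], 0) = (w, 0)"
  using assms(2)
  by (induction w arbitrary: u) (auto simp: word_act_append word_act_edge_word[OF assms(1)])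

text \<open>
  Composed with the action, reading off labels is the identity of \<open>W\<close>. This gives the injectivity
  of the homomorphism from the surface group for free.
\<close>

lemma raag_word_faithful:
  assumes "n \<ge> 5" "set w \<subseteq> {..<5}" "set w' \<subseteq> {..<5}"
    and "pres_eq {..<n} (anticycle_relators n) (raag_word n u w) (raag_word n u' w')"
  shows "w \<doteq> w'"
  using word_act_pres_eq[OF assms(1,4), of "([], 0)"] word_act_raag_word[OF assms(1)] assms(2,3)
  by (simp add: weq_at_def)

text \<open>
  The defining relators only say that two positive letters commute. The next lemmas extend this to
  inverse letters and to words.
\<close>

definition commutes :: "'a set \<Rightarrow> 'a word set \<Rightarrow> 'a word \<Rightarrow> 'a word \<Rightarrow> bool"
  where "commutes X R u v \<longleftrightarrow> pres_eq X R (u @ v) (v @ u)"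

lemma commutes_sym: "commutes X R u v \<Longrightarrow> commutes X R v u"
  unfolding commutes_def by (rule pres_eq.sym)

lemma commutes_Nil [simp]: "commutes X R u []"
  by (simp add: commutes_def pres_eq.refl)

lemma commutes_append:
  assumes "commutes X R u v" "commutes X R u w"
  shows "commutes X R u (v @ w)"
proof -
  have "pres_eq X R ((u @ v) @ w) ((v @ u) @ w)"
    using assms(1) by (intro pres_eq_append[OF _ pres_eq.refl]) (simp add: commutes_def)
  moreover have "pres_eq X R (v @ (u @ w)) (v @ (w @ u))"
    using assms(2) by (intro pres_eq_append[OF pres_eq.refl]) (simp add: commutes_def)
  ultimately show ?thesis by (auto simp: commutes_def intro: pres_eq.trans)
qed

lemma commutes_letter_inv:
  assumes "commutes X R u [(x, b)]" "x \<in> X"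
  shows "commutes X R u [(x, \<not> b)]"
proof -
  let ?x = "[(x, b)]" and ?y = "[(x, \<not> b)]"
  have "pres_eq X R (u @ ?y) (?y @ (?x @ u) @ ?y)"
    using pres_eq.cancel[OF assms(2), of R "[]" "\<not> b" "u @ ?y"] by (simp add: pres_eq.sym)
  also have "pres_eq X R (?y @ (?x @ u) @ ?y) (?y @ (u @ ?x) @ ?y)"
    using pres_eq.sym[OF assms(1)[unfolded commutes_def]]
    by (intro pres_eq_append[OF pres_eq.refl] pres_eq_append[OF _ pres_eq.refl])
  finally (pres_eq.trans) have *: "pres_eq X R (u @ ?y) (?y @ (u @ ?x) @ ?y)" .
  have "pres_eq X R (?y @ (u @ ?x) @ ?y) (?y @ u)"
    using pres_eq.cancel[OF assms(2), of R "?y @ u" b "[]"] by simp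
  with * show ?thesis unfolding commutes_def by (rule pres_eq.trans)
qed

lemma commutes_letters:
  assumes "n \<ge> 5" "{v, w} \<in> complement_edges {..<n} (cycle_edges n)"
  shows "commutes {..<n} (anticycle_relators n) [(v, b)] [(w, c)]"
proof -
  let ?X = "{..<n}" and ?R = "anticycle_relators n"
  note e = complement_cycle_edgeD[OF assms(2)]
  have "[(v, True), (w, True), (v, False), (w, False)] \<in> ?R" using assms by blast
  from pres_eq.relator[OF this, of ?X "[]" "[(w, True), (v, True)]"]
  have 1: "pres_eq ?X ?R [(w, True), (v, True)]
     ([(v, True), (w, True), (v, False)] @ [(w, False), (w, \<not> False)] @ [(v, True)])"
    by (simp add: pres_eq.sym)
  also have "pres_eq ?X ?R \<dots> ([(v, True), (w, True)] @ [(v, False), (v, \<not> False)] @ [])"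
    using pres_eq.cancel[of w ?X ?R "[(v, True), (w, True), (v, False)]" False "[(v, True)]"] e by simp
  also (pres_eq.trans) have "pres_eq ?X ?R \<dots> ([(v, True), (w, True)] @ [])"
    by (rule pres_eq.cancel) (use e in simp)
  finally (pres_eq.trans) have "commutes ?X ?R [(v, True)] [(w, True)]"
    by (simp add: commutes_def pres_eq.sym)
  then have "commutes ?X ?R [(v, True)] [(w, c)]"
    using commutes_letter_inv[of ?X ?R "[(v, True)]" w True] e by (cases c) auto
  then show ?thesis
    using commutes_letter_inv[of ?X ?R "[(w, c)]" v True, OF commutes_sym] e commutes_sym
    by (cases b) auto
qed

lemma commutes_word:
  assumes "n \<ge> 5" "\<And>v b. (v, b) \<in> set u \<Longrightarrow> {x, v} \<in> complement_edges {..<n} (cycle_edges n)"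
  shows "commutes {..<n} (anticycle_relators n) [(x, c)] u"
  using assms(2)
proof (induction u)
  case (Cons l u)
  obtain v b where l: "l = (v, b)" by force
  have "commutes {..<n} (anticycle_relators n) [(x, c)] ([(v, b)] @ u)"
    by (rule commutes_append) (use Cons assms(1) in \<open>auto simp: l intro: commutes_letters\<close>)
  then show ?case by (simp add: l)
qed simp

lemma edge_word_commute:
  assumes "n \<ge> 5" "adj i j"
  shows "commutes {..<n} (anticycle_relators n) (edge_word n b i) (edge_word n c j)"
proof -
  have m: "Suc x mod n = (if Suc x = n then 0 else Suc x)" if "x < n" for x
    using that by auto
  have m4: "5 mod n = (if n = 5 then 0 else 5)"
    using assms by auto
  let ?C = "\<lambda>i j. \<forall>b c. commutes {..<n} (anticycle_relators n) (edge_word n b i) (edge_word n c j)"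
  have "?C 0 1" "?C 3 4" "?C 4 0"
    unfolding edge_word_def
    using assms(1) by (auto intro!: commutes_letters complement_cycle_edgeI simp: mod_if)
  moreover have "?C 1 2" "?C 3 2"
    unfolding edge_word_def
    using assms(1)
    by (auto intro!: commutes_word complement_cycle_edgeI simp: m m4 conjugator_def conjugator_inv_def split: if_splits)
  moreover have "?C j i" if "?C i j" for i j
    using that commutes_sym by blast
  ultimately show ?thesis
    using assms(2) unfolding adj_iff by blast
qed

lemma conjugator_left_inverse:
  assumes "n \<ge> 5"
  shows "pres_eq {..<n} R (conjugator_inv n @ conjugator n) []"
proof -
  have "conjugator n \<in> words_over {..<n}" by (auto simp: words_over_def conjugator_def)
  from pres_eq_inverse[OF this, of R] show ?thesis
    by (simp add: conjugator_def conjugator_inv_def rev_map o_def)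
qed

lemma conjugator_right_inverse:
  assumes "n \<ge> 5"
  shows "pres_eq {..<n} R (conjugator n @ conjugator_inv n) []"
proof -
  have "conjugator_inv n \<in> words_over {..<n}" by (auto simp: words_over_def conjugator_inv_def)
  from pres_eq_inverse[OF this, of R] show ?thesis
    by (simp add: conjugator_def conjugator_inv_def rev_map o_def)
qed

lemma edge_word_cancel:
  assumes "n \<ge> 5" "k < 5"
  shows "pres_eq {..<n} R (edge_word n b k @ edge_word n (\<not> b) k) []"
proof (cases "k = 2")
  case False
  then show ?thesis using assms pres_eq.cancel[of _ "{..<n}" R "[]" b "[]"]
    by (auto simp: edge_word_def)
next
  case True
  have "pres_eq {..<n} R ((conjugator n @ [(4, b)]) @ (conjugator_inv n @ conjugator n) @ ([(4, \<not> b)] @ conjugator_inv n))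
      ((conjugator n @ [(4, b)]) @ [] @ ([(4, \<not> b)] @ conjugator_inv n))"
    by (intro pres_eq_append pres_eq.refl conjugator_left_inverse assms)
  also have "pres_eq {..<n} R ((conjugator n @ [(4, b)]) @ [] @ ([(4, \<not> b)] @ conjugator_inv n)) (conjugator n @ conjugator_inv n)"
    using pres_eq.cancel[of 4 "{..<n}" R "conjugator n" b "conjugator_inv n"] assms by simp
  also (pres_eq.trans) have "pres_eq {..<n} R \<dots> []"
    by (rule conjugator_right_inverse[OF assms(1)])
  finally (pres_eq.trans) show ?thesis using True by (simp add: edge_word_def)
qed

text \<open>
  Conversely the labels of homotopic edge paths agree in the Artin group: a cancelled pair of edges
  has inverse labels, and the sides of a square have commuting labels.
\<close>

lemma raag_word_weq:
  assumes "n \<ge> 5" "w \<doteq> w'"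
  shows "pres_eq {..<n} (anticycle_relators n) (raag_word n u w) (raag_word n u w')"
  using assms(2)
proof (induction arbitrary: u rule: weq.induct)
  case (sym v w)
  then show ?case using pres_eq.sym by blast
next
  case (trans u v w)
  then show ?case using pres_eq.trans by blast
next
  case (cancel i w)
  have "pres_eq {..<n} (anticycle_relators n)
     ((edge_word n (i \<notin> u) i @ edge_word n (\<not> i \<notin> u) i) @ raag_word n u w) ([] @ raag_word n u w)"
    by (intro pres_eq_append pres_eq.refl edge_word_cancel assms cancel)
  then show ?case by (simp add: flip_mem_iff)
next
  case (swap i j w)
  then have ij: "i \<noteq> j" by (rule adj_irrefl)
  have "pres_eq {..<n} (anticycle_relators n)
     ((edge_word n (i \<notin> u) i @ edge_word n (j \<notin> u) j) @ raag_word n (flip j (flip i u)) w)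
     ((edge_word n (j \<notin> u) j @ edge_word n (i \<notin> u) i) @ raag_word n (flip j (flip i u)) w)"
    using edge_word_commute[OF assms(1) swap, of "i \<notin> u" "j \<notin> u"]
    by (intro pres_eq_append[OF _ pres_eq.refl]) (simp add: commutes_def)
  then show ?case using ij flip_commute[of i j u] by (simp add: flip_mem_iff)
qed (auto intro: pres_eq.refl pres_eq_append)

lemma raag_word_append: "raag_word n u (w @ w') = raag_word n u w @ raag_word n (fold flip w u) w'"
  by (induction w arbitrary: u) auto

lemma raag_word_words_over:
  assumes "n \<ge> 5"
  shows "raag_word n u w \<in> words_over {..<n}"
proof -
  have "edge_word n b k \<in> words_over {..<n}" for b k
    using assms by (auto simp: edge_word_def words_over_def conjugator_def conjugator_inv_def)
  then show ?thesis
    by (induction w arbitrary: u) (auto simp: words_over_def)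
qed

section \<open>A surface tiled by squares\<close>

text \<open>
  The surface is the union of the squares of the cube \<open>[0, 1]\<^sup>5\<close> that are parallel to two
  cyclically consecutive directions, seen in \<open>nat \<Rightarrow> real\<close> by padding with zeros. It is the
  quotient of the Davis complex of \<open>W\<close> by the commutator subgroup of \<open>W\<close>; a neighbourhood of each of
  its 32 corners is a cone over a pentagon.
\<close>

definition corner :: "nat set \<Rightarrow> nat \<Rightarrow> real"
  where "corner u j = (if j \<in> u then 1 else 0)"

text \<open>
  The square through the corner \<open>u\<close> in the directions \<open>i\<close> and \<open>i + 1\<close>; it has four such
  descriptions, one for each of its corners.
\<close>

definition face :: "nat set \<Rightarrow> nat \<Rightarrow> (nat \<Rightarrow> real) set"
  where "face u i =
    {x. (\<forall>j. 0 \<le> x j \<and> x j \<le> 1) \<and> (\<forall>j. j \<noteq> i \<and> j \<noteq> Suc i mod 5 \<longrightarrow> x j = corner u j)}"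

definition cube_surface :: "(nat \<Rightarrow> real) set"
  where "cube_surface = (\<Union>u\<in>Pow {..<5}. \<Union>i<5. face u i)"

definition corner_star :: "nat set \<Rightarrow> (nat \<Rightarrow> real) set"
  where "corner_star v = {x \<in> cube_surface. \<forall>j<5. \<bar>x j - corner v j\<bar> < 1}"

definition segment :: "(nat \<Rightarrow> real) \<Rightarrow> (nat \<Rightarrow> real) \<Rightarrow> real \<Rightarrow> nat \<Rightarrow> real"
  where "segment x y t j = (1 - t) * x j + t * y j"

lemma segment_0 [simp]: "segment x y 0 = x" and segment_1 [simp]: "segment x y 1 = y"
  by (auto simp: segment_def fun_eq_iff)

lemma pathstart_segment [simp]: "pathstart (segment x y) = x"
  and pathfinish_segment [simp]: "pathfinish (segment x y) = y"
  by (simp_all add: pathstart_def pathfinish_def)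

lemma path_segment [simp]: "path (segment x y)"
  unfolding path_def segment_def
  by (intro continuous_on_coordinatewise_then_product continuous_intros)

lemma faceD:
  assumes "x \<in> face u i"
  shows "0 \<le> x j" "x j \<le> 1" "j \<noteq> i \<Longrightarrow> j \<noteq> Suc i mod 5 \<Longrightarrow> x j = corner u j"
  using assms by (auto simp: face_def)

lemma segment_in_face:
  assumes "x \<in> face u i" "y \<in> face u i" "t \<in> {0..1}"
  shows "segment x y t \<in> face u i"
  unfolding face_def mem_Collect_eq
proof (intro conjI allI impI)
  fix j
  note x = faceD[OF assms(1), of j] and y = faceD[OF assms(2), of j]
  show "0 \<le> segment x y t j" "segment x y t j \<le> 1"
    using x y assms(3) convex_bound_le[of "x j" 1 "y j" "1 - t" t] by (auto simp: segment_def)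
  show "segment x y t j = corner u j" if "j \<noteq> i \<and> j \<noteq> Suc i mod 5"
    using x y that by (simp add: segment_def algebra_simps)
qed

text \<open>
  The straight-line homotopy; on functions it is continuous since it is so in each coordinate.
\<close>

lemma segment_homotopy:
  fixes p q :: "real \<Rightarrow> nat \<Rightarrow> real"
  assumes "path p" "path q" "pathstart q = pathstart p" "pathfinish q = pathfinish p"
    and "\<And>s t. s \<in> {0..1} \<Longrightarrow> t \<in> {0..1} \<Longrightarrow> segment (p t) (q t) s \<in> S"
  shows "homotopic_paths S p q"
proof -
  have "continuous_on ({0..1} \<times> {0..1}) (\<lambda>y :: real \<times> real. r (snd y) j)"
    if "path r" for r :: "real \<Rightarrow> nat \<Rightarrow> real" and j
    using continuous_on_product_then_coordinatewise[of "{0..1}" r j] that unfolding path_def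
    by (intro continuous_on_compose2[of "{0..1}" "\<lambda>t. r t j" _ snd] continuous_on_snd continuous_on_id) auto
  then have "continuous_on ({0..1} \<times> {0..1}) (\<lambda>y. segment (p (snd y)) (q (snd y)) (fst y))"
    unfolding segment_def using assms(1,2)
    by (intro continuous_on_coordinatewise_then_product continuous_intros)
  moreover have "segment x x s = x" for x s
    by (auto simp: segment_def fun_eq_iff algebra_simps)
  ultimately show ?thesis
    unfolding homotopic_paths using assms(3-5)
    by (intro exI[of _ "\<lambda>y. segment (p (snd y)) (q (snd y)) (fst y)"])
      (auto simp: pathstart_def pathfinish_def)
qed

lemma face_subset: "u \<subseteq> {..<5} \<Longrightarrow> i < 5 \<Longrightarrow> face u i \<subseteq> cube_surface"
  unfolding cube_surface_def by blast

lemma homotopic_in_face: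
  assumes "u \<subseteq> {..<5}" "i < 5" "path p" "path q" "path_image p \<subseteq> face u i" "path_image q \<subseteq> face u i"
    "pathstart q = pathstart p" "pathfinish q = pathfinish p"
  shows "homotopic_paths cube_surface p q"
  using assms face_subset[OF assms(1,2)]
  by (intro segment_homotopy) (auto simp: path_image_def intro!: subsetD[OF _ segment_in_face])

lemma cube_surfaceE:
  assumes "x \<in> cube_surface"
  obtains u i where "u \<subseteq> {..<5}" "i < 5" "x \<in> face u i"
  using assms by (auto simp: cube_surface_def)

text \<open>
  A point of a square is close to a corner only if that corner belongs to the square. This makes
  the open stars of corners a cover whose nerve is controlled by the squares.
\<close>

lemma corner_in_face:
  assumes "u \<subseteq> {..<5}" "v \<subseteq> {..<5}" "i < 5" "x \<in> face u i" "x \<in> corner_star v"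
  shows "corner v \<in> face u i"
  unfolding face_def mem_Collect_eq
proof (intro conjI allI impI)
  fix j assume j: "j \<noteq> i \<and> j \<noteq> Suc i mod 5"
  show "corner v j = corner u j"
  proof (cases "j < 5")
    case True
    then have "\<bar>corner u j - corner v j\<bar> < 1"
      using assms(4,5) j by (auto simp: face_def corner_star_def)
    then show ?thesis by (auto simp: corner_def split: if_splits)
  next
    case False
    then show ?thesis using assms(1,2) by (auto simp: corner_def)
  qed
qed (auto simp: corner_def)

lemma corner_in_face_self: "corner v \<in> face v i"
  by (auto simp: face_def corner_def)

lemma corner_in_surface: "v \<subseteq> {..<5} \<Longrightarrow> corner v \<in> cube_surface"
  using corner_in_face_self[of v 0] face_subset[of v 0] by auto

lemma corner_in_star: "v \<subseteq> {..<5} \<Longrightarrow> corner v \<in> corner_star v"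
  by (simp add: corner_star_def corner_in_surface)

lemma corner_in_star_iff:
  assumes "u \<subseteq> {..<5}" "v \<subseteq> {..<5}"
  shows "corner u \<in> corner_star v \<longleftrightarrow> u = v"
proof
  assume "corner u \<in> corner_star v"
  then have "\<forall>j<5. \<bar>corner u j - corner v j\<bar> < 1" by (simp add: corner_star_def)
  then have "\<forall>j<5. j \<in> u \<longleftrightarrow> j \<in> v" by (fastforce simp: corner_def split: if_splits)
  then show "u = v" using assms by (auto simp: subset_iff)
qed (use corner_in_star assms in auto)

text \<open>
  Rounding the coordinates gives a corner whose star contains the point.
\<close>

lemma in_some_star:
  assumes "x \<in> cube_surface"
  obtains v where "v \<subseteq> {..<5}" "x \<in> corner_star v"
proof -
  obtain u i where "x \<in> face u i" using assms by (rule cube_surfaceE)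
  note x = faceD[OF this]
  have "\<bar>x j - corner {j. j < 5 \<and> x j > 1/2} j\<bar> < 1" if "j < 5" for j
    using x(1)[of j] x(2)[of j] that by (auto simp: corner_def abs_less_iff)
  then have "x \<in> corner_star {j. j < 5 \<and> x j > 1/2}"
    using assms by (simp add: corner_star_def)
  then show ?thesis using that[of "{j. j < 5 \<and> x j > 1/2}"] by auto
qed

lemma openin_star: "openin (top_of_set cube_surface) (corner_star v)"
proof -
  have "open {x :: nat \<Rightarrow> real. \<bar>x j - corner v j\<bar> < 1}" for j
    by (intro open_Collect_less continuous_intros continuous_on_product_coordinates)
  then have "open (\<Inter>j<5. {x :: nat \<Rightarrow> real. \<bar>x j - corner v j\<bar> < 1})"
    by (intro open_INT) auto
  moreover have "corner_star v = cube_surface \<inter> (\<Inter>j<5. {x. \<bar>x j - corner v j\<bar> < 1})"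
    by (auto simp: corner_star_def)
  ultimately show ?thesis by (auto simp: openin_open)
qed

section \<open>Charts on the stars of corners\<close>

text \<open>
  The star of a corner is a cone over a pentagon, with one axis for each direction. The five axes
  are laid out in the plane along \<open>(1, 0), (1, 1), (0, 1), (- 1, 0), (0, - 1)\<close>. Consecutive
  vectors form bases of the plane whose cones tile it, so each point of the plane is a
  nonnegative combination of two consecutive vectors; \<open>fan_coord j\<close> is the coefficient of the
  \<open>j\<close>-th vector, as a piecewise linear function.
\<close>

definition fan_coord :: "nat \<Rightarrow> real \<times> real \<Rightarrow> real"
  where "fan_coord j = (\<lambda>(a, b).
    if j = 0 then max 0 (a - max 0 b)
    else if j = 1 then max 0 (min a b)
    else if j = 2 then max 0 (b - max 0 a)
    else if j = 3 then max 0 (- a)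
    else if j = 4 then max 0 (- b) else 0)"

definition fan_point :: "(nat \<Rightarrow> real) \<Rightarrow> real \<times> real"
  where "fan_point t = (t 0 + t 1 - t 3, t 1 + t 2 - t 4)"

definition in_fan :: "(nat \<Rightarrow> real) \<Rightarrow> bool"
  where "in_fan t \<longleftrightarrow> (\<forall>j. 0 \<le> t j) \<and> (\<exists>i<5. \<forall>j. j \<noteq> i \<and> j \<noteq> Suc i mod 5 \<longrightarrow> t j = 0)"

lemma fan_coord_fan_point:
  assumes "in_fan t"
  shows "fan_coord j (fan_point t) = t j"
proof -
  obtain i where i: "i < 5" and t: "\<And>j. j \<noteq> i \<Longrightarrow> j \<noteq> Suc i mod 5 \<Longrightarrow> t j = 0"
    and pos: "\<And>j. 0 \<le> t j"
    using assms by (auto simp: in_fan_def)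
  have "t j = 0" if "j > 4" using t[of j] i that by (auto simp: less_five)
  moreover have "fan_coord j (fan_point t) = t j" if "j < 5" for j
  proof -
    note p = pos[of 0] pos[of 1] pos[of 2] pos[of 3] pos[of 4]
    show ?thesis
      using i[unfolded less_five]
    proof (elim disjE)
      assume "i = 0"
      then have "t 2 = 0" "t 3 = 0" "t 4 = 0" using t by auto
      with p \<open>j < 5\<close> show ?thesis by (auto simp: fan_coord_def fan_point_def less_five)
    next
      assume "i = 1"
      then have "t 0 = 0" "t 3 = 0" "t 4 = 0" using t by auto
      with p \<open>j < 5\<close> show ?thesis by (auto simp: fan_coord_def fan_point_def less_five)
    next
      assume "i = 2"
      then have "t 0 = 0" "t 1 = 0" "t 4 = 0" using t by auto
      with p \<open>j < 5\<close> show ?thesis by (auto simp: fan_coord_def fan_point_def less_five)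
    next
      assume "i = 3"
      then have "t 0 = 0" "t 1 = 0" "t 2 = 0" using t by auto
      with p \<open>j < 5\<close> show ?thesis by (auto simp: fan_coord_def fan_point_def less_five)
    next
      assume "i = 4"
      then have "t 1 = 0" "t 2 = 0" "t 3 = 0" using t by auto
      with p \<open>j < 5\<close> show ?thesis by (auto simp: fan_coord_def fan_point_def less_five)
    qed
  qed
  ultimately show ?thesis by (cases "j < 5") (auto simp: fan_coord_def)
qed

lemma fan_point_fan_coord: "fan_point (\<lambda>j. fan_coord j z) = z"
  by (cases z) (auto simp: fan_point_def fan_coord_def)

lemma in_fan_fan_coord: "in_fan (\<lambda>j. fan_coord j z)"
proof -
  obtain a b where z: "z = (a, b)" by (cases z)
  have "\<exists>i<5. \<forall>j. j \<noteq> i \<and> j \<noteq> Suc i mod 5 \<longrightarrow> fan_coord j z = 0"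
  proof (cases "0 \<le> a"; cases "0 \<le> b")
    assume ab: "0 \<le> a" "0 \<le> b"
    show ?thesis
    proof (cases "b \<le> a")
      case True
      with ab show ?thesis by (intro exI[of _ 0]) (auto simp: fan_coord_def z)
    next
      case False
      with ab show ?thesis by (intro exI[of _ 1]) (auto simp: fan_coord_def z)
    qed
  next
    assume "0 \<le> a" "\<not> 0 \<le> b"
    then show ?thesis by (intro exI[of _ 4]) (auto simp: fan_coord_def z)
  next
    assume "\<not> 0 \<le> a" "0 \<le> b"
    then show ?thesis by (intro exI[of _ 2]) (auto simp: fan_coord_def z)
  next
    assume "\<not> 0 \<le> a" "\<not> 0 \<le> b"
    then show ?thesis by (intro exI[of _ 3]) (auto simp: fan_coord_def z)
  qed
  moreover have "0 \<le> fan_coord j z" for j by (simp add: fan_coord_def z)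
  ultimately show ?thesis by (simp add: in_fan_def)
qed

text \<open>
  The distance to the corner in each direction lies in \<open>[0, 1)\<close>; it is stretched to \<open>[0, \<infinity>)\<close> by
  \<open>y / (1 - y)\<close>, with inverse \<open>t / (1 + t)\<close>, so that the star is mapped onto the whole plane.
\<close>

definition chart :: "nat set \<Rightarrow> (nat \<Rightarrow> real) \<Rightarrow> real \<times> real"
  where "chart v x = fan_point (\<lambda>j. \<bar>x j - corner v j\<bar> / (1 - \<bar>x j - corner v j\<bar>))"

definition chart_inv :: "nat set \<Rightarrow> real \<times> real \<Rightarrow> nat \<Rightarrow> real"
  where "chart_inv v z j = \<bar>corner v j - fan_coord j z / (1 + fan_coord j z)\<bar>"

lemma continuous_on_fan_coord: "continuous_on UNIV (fan_coord j)"
  unfolding fan_coord_def case_prod_unfold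
  by (cases "j = 0"; cases "j = 1"; cases "j = 2"; cases "j = 3"; cases "j = 4")
    (auto intro!: continuous_intros)

lemma star_in_fan:
  assumes "v \<subseteq> {..<5}" "x \<in> corner_star v"
  shows "in_fan (\<lambda>j. \<bar>x j - corner v j\<bar> / (1 - \<bar>x j - corner v j\<bar>))"
proof -
  have "x \<in> cube_surface" using assms(2) by (simp add: corner_star_def)
  then obtain u i where ui: "u \<subseteq> {..<5}" "i < 5" "x \<in> face u i"
    by (rule cube_surfaceE)
  have c: "corner v \<in> face u i" using corner_in_face ui assms by blast
  have "\<bar>x j - corner v j\<bar> \<le> 1" for j
    using faceD(1,2)[OF ui(3), of j] by (auto simp: corner_def)
  then have "0 \<le> \<bar>x j - corner v j\<bar> / (1 - \<bar>x j - corner v j\<bar>)" for j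
    by (simp add: divide_nonneg_nonneg)
  moreover have "x j = corner v j" if "j \<noteq> i" "j \<noteq> Suc i mod 5" for j
    using faceD(3)[OF c that] faceD(3)[OF ui(3) that] by simp
  ultimately show ?thesis using ui(2) by (auto simp: in_fan_def)
qed

lemma chart_inv_in_star:
  assumes "v \<subseteq> {..<5}"
  shows "chart_inv v z \<in> corner_star v"
proof -
  define y where "y j = fan_coord j z / (1 + fan_coord j z)" for j
  obtain i where i: "i < 5" and fan0: "\<And>j. j \<noteq> i \<Longrightarrow> j \<noteq> Suc i mod 5 \<Longrightarrow> fan_coord j z = 0"
    and pos: "\<And>j. 0 \<le> fan_coord j z"
    using in_fan_fan_coord[of z] by (auto simp: in_fan_def)
  have y: "0 \<le> y j" "y j < 1" for j
    using pos[of j] by (auto simp: y_def divide_simps)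
  have inv: "chart_inv v z j = (if j \<in> v then 1 - y j else y j)" for j
    using y[of j] by (simp add: chart_inv_def corner_def flip: y_def)
  have "chart_inv v z \<in> face v i"
    unfolding face_def mem_Collect_eq
  proof (intro conjI allI impI)
    fix j
    show "0 \<le> chart_inv v z j" "chart_inv v z j \<le> 1"
      using y[of j] by (auto simp: inv)
    show "chart_inv v z j = corner v j" if "j \<noteq> i \<and> j \<noteq> Suc i mod 5"
      using fan0[of j] that by (simp add: inv corner_def y_def)
  qed
  moreover have "\<bar>chart_inv v z j - corner v j\<bar> < 1" for j
    using y[of j] by (auto simp: inv corner_def)
  ultimately show ?thesis using face_subset[OF assms i] by (auto simp: corner_star_def)
qed

lemma chart_inv_dist: "\<bar>chart_inv v z j - corner v j\<bar> = fan_coord j z / (1 + fan_coord j z)"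
proof -
  have "0 \<le> fan_coord j z" using in_fan_fan_coord[of z] by (auto simp: in_fan_def)
  then have "0 \<le> fan_coord j z / (1 + fan_coord j z)" "fan_coord j z / (1 + fan_coord j z) \<le> 1"
    by (auto simp: divide_simps)
  then obtain y where "fan_coord j z / (1 + fan_coord j z) = y" "0 \<le> y" "y \<le> 1"
    by blast
  then show ?thesis by (simp add: chart_inv_def corner_def)
qed

lemma star_homeomorphic_prod:
  assumes "v \<subseteq> {..<5}"
  shows "homeomorphism (corner_star v) UNIV (chart v) (chart_inv v)"
proof (rule homeomorphismI)
  have less: "\<bar>x j - corner v j\<bar> < 1" if "x \<in> corner_star v" "j < 5" for x j
    using that by (simp add: corner_star_def)
  have "continuous_on (corner_star v) (\<lambda>x. \<bar>x j - corner v j\<bar> / (1 - \<bar>x j - corner v j\<bar>))" if "j < 5" for j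
    using less[OF _ that]
    by (intro continuous_intros continuous_on_subset[OF continuous_on_product_coordinates]) fastforce+
  then show "continuous_on (corner_star v) (chart v)"
    unfolding chart_def fan_point_def
    by (intro continuous_on_Pair continuous_on_add continuous_on_diff) simp_all
  show "continuous_on UNIV (chart_inv v)"
  proof (rule continuous_on_coordinatewise_then_product)
    fix j
    have "0 \<le> fan_coord j z" for z using in_fan_fan_coord[of z] by (auto simp: in_fan_def)
    then have "1 + fan_coord j z \<noteq> 0" for z by (metis add_nonneg_eq_0_iff zero_le_one zero_neq_one)
    then show "continuous_on UNIV (\<lambda>z. chart_inv v z j)"
      unfolding chart_inv_def by (intro continuous_intros continuous_on_fan_coord) auto
  qed
  show "chart v ` corner_star v \<subseteq> UNIV" by simp
  show "chart_inv v ` UNIV \<subseteq> corner_star v" using chart_inv_in_star[OF assms] by auto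
  show "chart_inv v (chart v x) = x" if "x \<in> corner_star v" for x
  proof
    fix j
    have f: "fan_coord j (chart v x) = \<bar>x j - corner v j\<bar> / (1 - \<bar>x j - corner v j\<bar>)"
      unfolding chart_def using fan_coord_fan_point[OF star_in_fan[OF assms that]] .
    have "x \<in> cube_surface" using that by (simp add: corner_star_def)
    then obtain u i where ui: "u \<subseteq> {..<5}" "i < 5" "x \<in> face u i"
      by (rule cube_surfaceE)
    have x: "0 \<le> x j" "x j \<le> 1" using faceD(1,2)[OF ui(3)] by auto
    have "\<bar>x j - corner v j\<bar> < 1"
    proof (cases "j < 5")
      case False
      then have "j \<noteq> i" "j \<noteq> Suc i mod 5" using ui by (auto simp: less_five)
      then have "x j = corner u j" using faceD(3)[OF ui(3)] by blast
      then show ?thesis using False ui assms by (auto simp: corner_def)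
    qed (use less that in auto)
    then have "fan_coord j (chart v x) / (1 + fan_coord j (chart v x)) = \<bar>x j - corner v j\<bar>"
      unfolding f by (simp add: field_simps)
    then show "chart_inv v (chart v x) j = x j"
      using x by (auto simp: chart_inv_def corner_def)
  qed
  show "chart v (chart_inv v z) = z" for z
  proof -
    have "t / (1 + t) / (1 - t / (1 + t)) = t" if "0 \<le> t" for t :: real
    proof -
      have "1 - t / (1 + t) = 1 / (1 + t)" using that by (simp add: field_simps)
      then show ?thesis using that by simp
    qed
    then have "fan_coord j z / (1 + fan_coord j z) / (1 - fan_coord j z / (1 + fan_coord j z)) = fan_coord j z" for j
      using in_fan_fan_coord[of z] by (simp add: in_fan_def)
    then show ?thesis unfolding chart_def chart_inv_dist by (simp add: fan_point_fan_coord)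
  qed
qed

text \<open>
  Stars are homeomorphic to the plane, hence simply connected.
\<close>

lemma homotopic_in_star:
  assumes "v \<subseteq> {..<5}" "path p" "path q" "path_image p \<subseteq> corner_star v" "path_image q \<subseteq> corner_star v"
    "pathstart q = pathstart p" "pathfinish q = pathfinish p"
  shows "homotopic_paths cube_surface p q"
proof -
  note h = star_homeomorphic_prod[OF assms(1)]
  have cont: "continuous_on (corner_star v) (chart v)" "continuous_on UNIV (chart_inv v)"
    using h by (auto simp: homeomorphism_def)
  have "homotopic_paths UNIV (chart v \<circ> p) (chart v \<circ> q)"
    using assms cont
    by (intro homotopic_paths_linear path_continuous_image)
      (auto simp: pathstart_compose pathfinish_compose intro: continuous_on_subset)
  then have *: "homotopic_paths (corner_star v) (chart_inv v \<circ> (chart v \<circ> p)) (chart_inv v \<circ> (chart v \<circ> q))"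
    by (rule homotopic_paths_continuous_image[OF _ cont(2)]) (use chart_inv_in_star assms in auto)
  have inv: "chart_inv v (chart v x) = x" if "x \<in> corner_star v" for x
    using h that by (auto simp: homeomorphism_def)
  have "homotopic_paths (corner_star v) r (chart_inv v \<circ> (chart v \<circ> r))"
    if "path r" "path_image r \<subseteq> corner_star v" for r
    using that inv by (intro homotopic_paths_eq) (auto simp: path_image_def image_subset_iff)
  with * assms have "homotopic_paths (corner_star v) p q"
    by (meson homotopic_paths_sym homotopic_paths_trans)
  then show ?thesis by (rule homotopic_paths_subset) (auto simp: corner_star_def)
qed

section \<open>Edge paths\<close>

text \<open>
  The directions to be crossed from the corner \<open>u\<close> to the corner \<open>v\<close>. It is used for corners of a
  common square only, where the order of the at most two letters is irrelevant up to \<open>\<doteq>\<close>.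
\<close>

definition word_between :: "nat set \<Rightarrow> nat set \<Rightarrow> nat list"
  where "word_between u v = filter (\<lambda>i. (i \<in> u) \<noteq> (i \<in> v)) [0..<5]"

fun epath :: "nat set \<Rightarrow> nat list \<Rightarrow> real \<Rightarrow> nat \<Rightarrow> real"
  where
    "epath u [] = (\<lambda>_. corner u)"
  | "epath u (i # w) = segment (corner u) (corner (flip i u)) +++ epath (flip i u) w"

lemma flip_subset: "u \<subseteq> {..<5} \<Longrightarrow> i < 5 \<Longrightarrow> flip i u \<subseteq> {..<5}"
  by (auto simp: flip_def)

lemma fold_flip_subset: "u \<subseteq> {..<5} \<Longrightarrow> set w \<subseteq> {..<5} \<Longrightarrow> fold flip w u \<subseteq> {..<5}"
  by (induction w arbitrary: u) (auto simp: flip_subset)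

lemma mem_fold_flip: "k \<in> fold flip w u \<longleftrightarrow> (k \<in> u) \<noteq> odd (count_list w k)"
  by (induction w arbitrary: u) (auto simp: flip_mem_iff)

lemma set_word_between: "set (word_between u v) = {i. i < 5 \<and> (i \<in> u) \<noteq> (i \<in> v)}"
  by (auto simp: word_between_def)

lemma word_between_self [simp]: "word_between u u = []"
  by (simp add: word_between_def)

lemma fold_flip_word_between:
  assumes "u \<subseteq> {..<5}" "v \<subseteq> {..<5}"
  shows "fold flip (word_between u v) u = v"
proof -
  have "distinct w \<Longrightarrow> count_list w k = (if k \<in> set w then 1 else 0)" for w and k :: nat
    by (induction w) auto
  then have "count_list (word_between u v) k = (if k \<in> set (word_between u v) then 1 else 0)" for k
    by (simp add: word_between_def)
  then show ?thesis
    using assms by (auto simp: mem_fold_flip set_word_between set_eq_iff subset_iff)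
qed

lemma weq_letters: "w \<doteq> w' \<Longrightarrow> set w \<subseteq> {..<5} \<longleftrightarrow> set w' \<subseteq> {..<5}"
  by (induction rule: weq.induct) (auto simp: adj_less)

text \<open>
  Two commuting involutions generate a Klein four-group, so a word in them is determined by the
  parities of its letters.
\<close>

lemma weq_two_letters:
  assumes "adj a b" "set w \<subseteq> {a, b}"
  shows "w \<doteq> (if odd (count_list w a) then [a] else []) @ (if odd (count_list w b) then [b] else [])"
  using assms(2)
proof (induction w)
  case Nil
  then show ?case by (simp add: weq.refl)
next
  case (Cons c w)
  have ab: "a \<noteq> b" "a < 5" "b < 5"
    using adj_irrefl adj_less assms(1) by blast+
  let ?nf = "\<lambda>w. (if odd (count_list w a) then [a] else []) @ (if odd (count_list w b) then [b] else [])"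
  have "c # w \<doteq> c # ?nf w"
    using Cons by (intro weq.Cons) auto
  also have "c # ?nf w \<doteq> ?nf (c # w)"
  proof (cases "c = a")
    case True
    then show ?thesis using ab by (auto intro: weq.refl weq.cancel)
  next
    case False
    then have c: "c = b" using Cons.prems by auto
    have "[b, a, b] \<doteq> [a, b, b]"
      by (rule weq.swap[OF adj_sym[OF assms(1)]])
    also have "[a, b, b] \<doteq> [a]"
      using ab by (intro weq.Cons weq.cancel)
    finally show ?thesis
      using ab c weq.swap[OF adj_sym[OF assms(1)], of "[]"] by (auto intro: weq.refl weq.cancel)
  qed
  finally show ?case .
qed

lemma adj_Suc: "i < 5 \<Longrightarrow> adj i (Suc i mod 5)"
  by (simp add: adj_def)

lemma word_between_letters_in_face:
  assumes "corner u \<in> face A i" "corner v \<in> face A i"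
  shows "set (word_between u v) \<subseteq> {i, Suc i mod 5}"
proof
  fix j assume j: "j \<in> set (word_between u v)"
  show "j \<in> {i, Suc i mod 5}"
  proof (rule ccontr)
    assume "j \<notin> {i, Suc i mod 5}"
    then have "corner u j = corner v j"
      using faceD(3)[OF assms(1), of j] faceD(3)[OF assms(2), of j] by simp
    with j show False by (auto simp: set_word_between corner_def split: if_splits)
  qed
qed

lemma face_stars:
  assumes "x \<in> corner_star u" "u \<subseteq> {..<5}"
  obtains A i where "A \<subseteq> {..<5}" "i < 5" "x \<in> face A i"
    "\<And>v. v \<subseteq> {..<5} \<Longrightarrow> x \<in> corner_star v \<Longrightarrow> corner v \<in> face A i"
proof -
  have "x \<in> cube_surface" using assms(1) by (simp add: corner_star_def)
  then obtain A i where "A \<subseteq> {..<5}" "i < 5" "x \<in> face A i" by (rule cube_surfaceE)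
  then show ?thesis using that corner_in_face by blast
qed

text \<open>
  The cocycle condition for the cover by stars: corners whose stars have a common point lie on one
  square, so the words involve two commuting letters and only parities matter.
\<close>

lemma word_between_cocycle:
  assumes "u \<subseteq> {..<5}" "v \<subseteq> {..<5}" "w \<subseteq> {..<5}" "x \<in> corner_star u" "x \<in> corner_star v" "x \<in> corner_star w"
  shows "word_between u v @ word_between v w \<doteq> word_between u w"
proof -
  obtain A i where i: "i < 5"
    and c: "corner u \<in> face A i" "corner v \<in> face A i" "corner w \<in> face A i"
    using face_stars[OF assms(4,1)] assms by metis
  let ?l = "word_between u v @ word_between v w"
  have "k \<in> fold flip ?l u \<longleftrightarrow> k \<in> fold flip (word_between u w) u" for k
    using assms(1-3) by (simp add: fold_flip_word_between)
  then have parity: "odd (count_list ?l k) = odd (count_list (word_between u w) k)" for k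
    unfolding mem_fold_flip by blast
  have "?l \<doteq> (if odd (count_list ?l i) then [i] else []) @
      (if odd (count_list ?l (Suc i mod 5)) then [Suc i mod 5] else [])"
    using word_between_letters_in_face c by (intro weq_two_letters adj_Suc i) simp
  also have "\<dots> \<doteq> word_between u w"
    unfolding parity
    using word_between_letters_in_face c by (intro weq.sym[OF weq_two_letters] adj_Suc i) simp
  finally show ?thesis .
qed

lemma corner_flip_in_face:
  "corner u \<in> face A i \<Longrightarrow> k = i \<or> k = Suc i mod 5 \<Longrightarrow> corner (flip k u) \<in> face A i"
  by (auto simp: face_def corner_def flip_mem_iff)

lemma pathstart_epath [simp]: "pathstart (epath u w) = corner u"
  by (cases w) (auto simp: pathstart_def joinpaths_def)

lemma pathfinish_epath [simp]: "pathfinish (epath u w) = corner (fold flip w u)"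
  by (induction w arbitrary: u) (auto simp: pathfinish_def joinpaths_def)

lemma path_epath [simp]: "path (epath u w)"
  by (induction w arbitrary: u) (auto simp: path_def[of "\<lambda>_. corner _"])

lemma path_image_segment_face:
  "x \<in> face A i \<Longrightarrow> y \<in> face A i \<Longrightarrow> path_image (segment x y) \<subseteq> face A i"
  using segment_in_face by (auto simp: path_image_def)

lemma path_image_edge:
  assumes "u \<subseteq> {..<5}" "i < 5"
  shows "path_image (segment (corner u) (corner (flip i u))) \<subseteq> cube_surface"
  using path_image_segment_face[OF corner_in_face_self corner_flip_in_face[OF corner_in_face_self]]
    face_subset[OF assms] by blast

lemma path_image_epath:
  "u \<subseteq> {..<5} \<Longrightarrow> set w \<subseteq> {..<5} \<Longrightarrow> path_image (epath u w) \<subseteq> cube_surface"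
proof (induction w arbitrary: u)
  case Nil
  then show ?case using corner_in_surface by (auto simp: path_image_def)
next
  case (Cons i w)
  then show ?case using path_image_edge[of u i] flip_subset[of u i]
    by (auto simp: path_image_join)
qed

lemma path_image_epath_face:
  "corner u \<in> face A i \<Longrightarrow> set w \<subseteq> {i, Suc i mod 5} \<Longrightarrow> path_image (epath u w) \<subseteq> face A i"
proof (induction w arbitrary: u)
  case Nil
  then show ?case by (auto simp: path_image_def)
next
  case (Cons k w)
  then have c: "corner (flip k u) \<in> face A i" by (intro corner_flip_in_face) auto
  with Cons show ?case using path_image_segment_face[OF Cons.prems(1) c]
    by (auto simp: path_image_join)
qed

lemma const_path [simp]:
  "path (\<lambda>_. x)" "path_image (\<lambda>_. x) = {x}" "pathstart (\<lambda>_. x) = x" "pathfinish (\<lambda>_. x) = x"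
  by (auto simp: path_def path_image_def pathstart_def pathfinish_def)

lemma homotopic_const_join:
  assumes "path p" "path_image p \<subseteq> S" "pathstart p = x"
  shows "homotopic_paths S ((\<lambda>_. x) +++ p) p"
proof -
  have cont: "continuous_on {0..1} (\<lambda>t::real. max 0 (2 * t - 1))"
    by (intro continuous_intros)
  have "((\<lambda>_. x) +++ p) t = p (max 0 (2 * t - 1))" for t
    using assms by (cases "2 * t \<le> 1") (auto simp: joinpaths_def pathstart_def)
  then have "homotopic_paths S p ((\<lambda>_. x) +++ p)"
    using assms by (intro homotopic_paths_reparametrize[OF _ _ cont]) auto
  then show ?thesis by (rule homotopic_paths_sym)
qed

lemma homotopic_join_const:
  assumes "path p" "path_image p \<subseteq> S" "pathfinish p = x"
  shows "homotopic_paths S (p +++ (\<lambda>_. x)) p"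
proof -
  have cont: "continuous_on {0..1} (\<lambda>t::real. min 1 (2 * t))"
    by (intro continuous_intros)
  have "(p +++ (\<lambda>_. x)) t = p (min 1 (2 * t))" for t
    using assms by (cases "2 * t \<le> 1") (auto simp: joinpaths_def pathfinish_def)
  then have "homotopic_paths S p (p +++ (\<lambda>_. x))"
    using assms by (intro homotopic_paths_reparametrize[OF _ _ cont]) auto
  then show ?thesis by (rule homotopic_paths_sym)
qed

lemma epath_append:
  assumes "u \<subseteq> {..<5}" "set w \<subseteq> {..<5}" "set w' \<subseteq> {..<5}"
  shows "homotopic_paths cube_surface (epath u w +++ epath (fold flip w u) w') (epath u (w @ w'))"
  using assms(1,2)
proof (induction w arbitrary: u)
  case Nil
  then show ?case using assms(3) by (simp add: homotopic_const_join path_image_epath)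
next
  case (Cons i w)
  let ?e = "segment (corner u) (corner (flip i u))"
  have u': "flip i u \<subseteq> {..<5}" and i: "i < 5" and w: "set w \<subseteq> {..<5}"
    using Cons.prems flip_subset by auto
  have "homotopic_paths cube_surface ((?e +++ epath (flip i u) w) +++ epath (fold flip w (flip i u)) w')
      (?e +++ (epath (flip i u) w +++ epath (fold flip w (flip i u)) w'))"
    by (intro homotopic_paths_sym[OF homotopic_paths_assoc])
      (simp_all add: path_image_edge path_image_epath fold_flip_subset Cons.prems(1) u' i w assms(3))
  also have "homotopic_paths cube_surface \<dots> (?e +++ epath (flip i u) (w @ w'))"
    by (intro homotopic_paths_join Cons.IH u' w)
      (simp_all add: path_image_edge Cons.prems(1) i)
  finally show ?case by simp
qed

text \<open>
  Every move on words is a homotopy of edge paths, because squares are convex.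
\<close>

lemma epath_weq:
  assumes "w \<doteq> w'" "u \<subseteq> {..<5}" "set w \<subseteq> {..<5}"
  shows "homotopic_paths cube_surface (epath u w) (epath u w')"
  using assms
proof (induction arbitrary: u rule: weq.induct)
  case (refl w)
  then show ?case by (simp add: path_image_epath)
next
  case (sym v w)
  then have "set v \<subseteq> {..<5}" using weq_letters[OF sym.hyps] by simp
  with sym show ?case by (simp add: homotopic_paths_sym)
next
  case (trans x y z)
  then have "set y \<subseteq> {..<5}" using weq_letters[OF trans.hyps(1)] by simp
  with trans show ?case by (meson homotopic_paths_trans)
next
  case (Cons v w i)
  then show ?case by (auto intro!: homotopic_paths_join simp: path_image_edge flip_subset)
next
  case (cancel i w)
  let ?e = "segment (corner u) (corner (flip i u))" and ?e' = "segment (corner (flip i u)) (corner u)"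
  have w: "set w \<subseteq> {..<5}" using cancel by simp
  have f: "corner u \<in> face u i" "corner (flip i u) \<in> face u i"
    by (auto intro: corner_in_face_self corner_flip_in_face)
  have pi: "path_image ?e \<subseteq> face u i" "path_image ?e' \<subseteq> face u i"
    by (intro path_image_segment_face f)+
  note fs = face_subset[OF cancel.prems(1) cancel.hyps]
  have "homotopic_paths cube_surface (?e +++ (?e' +++ epath u w)) ((?e +++ ?e') +++ epath u w)"
    using pi fs by (intro homotopic_paths_assoc) (auto simp: path_image_epath cancel.prems(1) w)
  also have "homotopic_paths cube_surface \<dots> ((\<lambda>_. corner u) +++ epath u w)"
    using pi f
    by (intro homotopic_paths_join[OF homotopic_in_face[OF cancel.prems(1) cancel.hyps]])
      (auto simp: path_image_join path_image_epath cancel.prems(1) w)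
  also have "homotopic_paths cube_surface \<dots> (epath u w)"
    by (intro homotopic_const_join) (auto simp: path_image_epath cancel.prems(1) w)
  finally show ?case by simp
next
  case (swap i j w)
  let ?x = "corner u" and ?y = "corner (flip i u)" and ?z = "corner (flip j u)"
    and ?t = "corner (flip j (flip i u))" and ?q = "epath (flip j (flip i u)) w"
  have ij: "i < 5" "j < 5" and w: "set w \<subseteq> {..<5}"
    using swap adj_less by auto
  obtain k where k: "k < 5" "i = k \<and> j = Suc k mod 5 \<or> j = k \<and> i = Suc k mod 5"
    using swap.hyps unfolding adj_def by blast
  have f: "?x \<in> face u k" "?y \<in> face u k" "?z \<in> face u k" "?t \<in> face u k"
    using k by (auto intro!: corner_in_face_self corner_flip_in_face)
  have pi: "path_image (segment ?x ?y) \<subseteq> face u k" "path_image (segment ?y ?t) \<subseteq> face u k"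
    "path_image (segment ?x ?z) \<subseteq> face u k" "path_image (segment ?z ?t) \<subseteq> face u k"
    by (intro path_image_segment_face f)+
  note fs = face_subset[OF swap.prems(1) k(1)]
  have q: "path_image ?q \<subseteq> cube_surface"
    by (intro path_image_epath flip_subset swap.prems(1) ij w)
  have "homotopic_paths cube_surface (segment ?x ?y +++ (segment ?y ?t +++ ?q)) ((segment ?x ?y +++ segment ?y ?t) +++ ?q)"
    using pi fs q by (intro homotopic_paths_assoc) auto
  also have "homotopic_paths cube_surface \<dots> ((segment ?x ?z +++ segment ?z ?t) +++ ?q)"
    using pi q
    by (intro homotopic_paths_join[OF homotopic_in_face[OF swap.prems(1) k(1)]]) (auto simp: path_image_join)
  also have "homotopic_paths cube_surface \<dots> (segment ?x ?z +++ (segment ?z ?t +++ ?q))"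
    using pi fs q by (intro homotopic_paths_sym[OF homotopic_paths_assoc]) auto
  finally show ?case by (simp add: flip_commute[of i j])
qed

section \<open>The word traced by a path\<close>

text \<open>
  If a path visits the stars of the corners \<open>vs 0, \<dots>, vs k\<close> in this order, then its itinerary is
  the word of an edge path through these corners.
\<close>

fun itinerary :: "(nat \<Rightarrow> nat set) \<Rightarrow> nat \<Rightarrow> nat list"
  where
    "itinerary vs 0 = []"
  | "itinerary vs (Suc k) = itinerary vs k @ word_between (vs k) (vs (Suc k))"

definition subdivides :: "(real \<Rightarrow> nat \<Rightarrow> real) \<Rightarrow> (nat \<Rightarrow> nat set) \<Rightarrow> nat \<Rightarrow> bool"
  where "subdivides p vs N \<longleftrightarrow>
    0 < N \<and> (\<forall>i<N. vs i \<subseteq> {..<5} \<and> (\<forall>t\<in>{real i / real N..real (Suc i) / real N}. p t \<in> corner_star (vs i)))"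

text \<open>
  A path traces a word if the word is its itinerary for some uniform subdivision and some choice of
  stars. Up to \<open>\<doteq>\<close> the word depends only on the homotopy class of the path; this is the holonomy of
  the cocycle \<open>word_between\<close>, and it replaces the theory of covering spaces.
\<close>

definition traces :: "(real \<Rightarrow> nat \<Rightarrow> real) \<Rightarrow> nat list \<Rightarrow> bool"
  where "traces p w \<longleftrightarrow> (\<exists>vs N. subdivides p vs N \<and> w = itinerary vs (N - 1))"

lemma set_itinerary: "set (itinerary vs k) \<subseteq> {..<5}"
  by (induction k) (auto simp: set_word_between)

lemma subdividesD:
  assumes "subdivides p vs N" "i < N"
  shows "vs i \<subseteq> {..<5}" "\<And>t. real i / real N \<le> t \<Longrightarrow> t \<le> real (Suc i) / real N \<Longrightarrow> p t \<in> corner_star (vs i)"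
  using assms by (auto simp: subdivides_def)

lemma subdivides_first:
  assumes "subdivides p vs N" "p 0 = corner u" "u \<subseteq> {..<5}"
  shows "vs 0 = u"
proof -
  have N: "0 < N" using assms(1) by (simp add: subdivides_def)
  have "p 0 \<in> corner_star (vs 0)"
    by (rule subdividesD(2)[OF assms(1) N]) simp_all
  with subdividesD(1)[OF assms(1) N] assms(2,3) show ?thesis
    using corner_in_star_iff by auto
qed

lemma subdivides_last:
  assumes "subdivides p vs N" "p 1 = corner u" "u \<subseteq> {..<5}"
  shows "vs (N - 1) = u"
proof -
  have N: "0 < N" "N - 1 < N" using assms(1) by (auto simp: subdivides_def)
  have "p 1 \<in> corner_star (vs (N - 1))"
    by (rule subdividesD(2)[OF assms(1) N(2)]) (use N in \<open>auto simp: divide_simps\<close>)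
  with subdividesD(1)[OF assms(1) N(2)] assms(2,3) show ?thesis
    using corner_in_star_iff by auto
qed

text \<open>
  Two choices of stars for the same subdivision are compared by a ladder, with a rung at each
  division point. Each rung commutes with the next step by the cocycle condition at that point.
\<close>

lemma itinerary_ladder:
  assumes s: "subdivides p vs N" "subdivides p vs' N" and "vs 0 = vs' 0" and "k < N"
  shows "itinerary vs k @ word_between (vs k) (vs' k) \<doteq> itinerary vs' k"
  using assms(4)
proof (induction k)
  case 0
  then show ?case using assms(3) by (simp add: weq.refl)
next
  case (Suc k)
  then have k: "k < N" by simp
  let ?t = "real (Suc k) / real N"
  have t: "real k / real N \<le> ?t" "?t \<le> real (Suc (Suc k)) / real N"
    using k by (auto simp: divide_simps)
  note v = subdividesD[OF s(1) k] and v1 = subdividesD[OF s(1) Suc.prems]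
    and v' = subdividesD[OF s(2) k] and v1' = subdividesD[OF s(2) Suc.prems]
  have p: "p ?t \<in> corner_star (vs k)" "p ?t \<in> corner_star (vs (Suc k))" "p ?t \<in> corner_star (vs' k)" "p ?t \<in> corner_star (vs' (Suc k))"
    using v(2)[OF t(1)] v1(2)[OF _ t(2)] v'(2)[OF t(1)] v1'(2)[OF _ t(2)] by auto
  have "itinerary vs (Suc k) @ word_between (vs (Suc k)) (vs' (Suc k))
      = itinerary vs k @ (word_between (vs k) (vs (Suc k)) @ word_between (vs (Suc k)) (vs' (Suc k)))"
    by simp
  also have "\<dots> \<doteq> itinerary vs k @ word_between (vs k) (vs' (Suc k))"
    by (rule weq_append_left[OF word_between_cocycle[OF v(1) v1(1) v1'(1) p(1,2,4)]])
  also have "\<dots> \<doteq> itinerary vs k @ (word_between (vs k) (vs' k) @ word_between (vs' k) (vs' (Suc k)))"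
    by (rule weq.sym[OF weq_append_left[OF word_between_cocycle[OF v(1) v'(1) v1'(1) p(1,3,4)]]])
  also have "\<dots> = (itinerary vs k @ word_between (vs k) (vs' k)) @ word_between (vs' k) (vs' (Suc k))"
    by simp
  also have "\<dots> \<doteq> itinerary vs' k @ word_between (vs' k) (vs' (Suc k))"
    by (rule weq_append_right[OF Suc.IH[OF k]])
  finally show ?case by simp
qed

lemma subdivides_refine:
  assumes "subdivides p vs N" "0 < M"
  shows "subdivides p (\<lambda>j. vs (j div M)) (N * M)"
  unfolding subdivides_def
proof (intro conjI allI impI ballI)
  have N: "0 < N" using assms(1) by (simp add: subdivides_def)
  then show "0 < N * M" using assms(2) by simp
  fix j assume j: "j < N * M"
  then have i: "j div M < N" by (simp add: less_mult_imp_div_less)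
  show "vs (j div M) \<subseteq> {..<5}" using subdividesD(1)[OF assms(1) i] .
  fix t assume t: "t \<in> {real j / real (N * M)..real (Suc j) / real (N * M)}"
  have "j div M * M \<le> j" "Suc j \<le> Suc (j div M) * M"
    using assms(2) by (auto simp: Suc_le_eq dividend_less_div_times)
  then have "real (j div M) * real M \<le> real j" "real (Suc j) \<le> real (Suc (j div M)) * real M"
    by (metis of_nat_le_iff of_nat_mult)+
  then have "real (j div M) / real N \<le> real j / real (N * M)"
    "real (Suc j) / real (N * M) \<le> real (Suc (j div M)) / real N"
    using N assms(2) by (simp_all add: divide_simps mult_ac)
  with t show "p t \<in> corner_star (vs (j div M))"
    by (intro subdividesD(2)[OF assms(1) i]) auto
qed

text \<open>
  Refining a subdivision repeats corners, and repetitions contribute the empty word.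
\<close>

lemma itinerary_refine:
  assumes "0 < M"
  shows "itinerary (\<lambda>j. vs (j div M)) k = itinerary vs (k div M)"
proof (induction k)
  case (Suc k)
  then show ?case by (simp add: div_Suc)
qed simp

lemma pred_mult_div:
  assumes "0 < N" "0 < (M :: nat)"
  shows "(N * M - 1) div M = N - 1"
proof -
  obtain n where "N = Suc n" using assms(1) gr0_implies_Suc by blast
  moreover obtain m where "M = Suc m" using assms(2) gr0_implies_Suc by blast
  moreover have "(m + n * Suc m) div Suc m = n" by (simp only: div_mult_self1) simp
  ultimately show ?thesis by (simp add: ac_simps)
qed

lemma traces_unique:
  assumes "traces p w" "traces p w'" "p 0 = corner u" "p 1 = corner v" "u \<subseteq> {..<5}" "v \<subseteq> {..<5}"
  shows "w \<doteq> w'"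
proof -
  obtain vs N vs' N' where s: "subdivides p vs N" "subdivides p vs' N'"
    and w: "w = itinerary vs (N - 1)" "w' = itinerary vs' (N' - 1)"
    using assms(1,2) by (auto simp: traces_def)
  have pos: "0 < N" "0 < N'" using s by (auto simp: subdivides_def)
  \<comment> \<open>pass to the common refinement into \<open>N * N'\<close> pieces\<close>
  let ?vs = "\<lambda>j. vs (j div N')" and ?vs' = "\<lambda>j. vs' (j div N)"
  have r: "subdivides p ?vs (N * N')" "subdivides p ?vs' (N * N')"
    using subdivides_refine[OF s(1) pos(2)] subdivides_refine[OF s(2) pos(1)] by (simp_all add: mult.commute)
  let ?k = "N * N' - 1"
  have "itinerary ?vs ?k @ word_between (?vs ?k) (?vs' ?k) \<doteq> itinerary ?vs' ?k"
    using r subdivides_first[OF s(1) assms(3,5)] subdivides_first[OF s(2) assms(3,5)] pos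
    by (intro itinerary_ladder) auto
  moreover have "?vs ?k = v" "?vs' ?k = v"
    using subdivides_last[OF r(1) assms(4,6)] subdivides_last[OF r(2) assms(4,6)] by auto
  ultimately have "itinerary ?vs ?k \<doteq> itinerary ?vs' ?k" by simp
  moreover have "itinerary ?vs ?k = w" "itinerary ?vs' ?k = w'"
    unfolding w itinerary_refine[OF pos(2)] itinerary_refine[OF pos(1)]
    using pred_mult_div[OF pos] pred_mult_div[OF pos(2,1)] by (simp_all add: mult.commute)
  ultimately show ?thesis by simp
qed

text \<open>
  A Lebesgue number of the cover by the preimages of the stars gives a grid on the square that is
  subordinate to this cover.
\<close>

lemma star_grid:
  assumes "continuous_on ({0..1} \<times> {0..1}) H" "H ` ({0..1} \<times> {0..1}) \<subseteq> cube_surface"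
  obtains N where "0 < (N::nat)"
    "\<And>i j. i < N \<Longrightarrow> j < N \<Longrightarrow> \<exists>v\<subseteq>{..<5}.
       \<forall>s\<in>{real i / real N..real (Suc i) / real N}.
       \<forall>t\<in>{real j / real N..real (Suc j) / real N}. H (s, t) \<in> corner_star v"
proof -
  let ?Q = "{0..1} \<times> {0..1} :: (real \<times> real) set"
  have "\<exists>T. open T \<and> ?Q \<inter> T = ?Q \<inter> H -` corner_star v" for v
  proof -
    have "openin (top_of_set ?Q) (?Q \<inter> H -` corner_star v)"
      using assms by (intro continuous_openin_preimage[OF _ _ openin_star]) auto
    then show ?thesis by (metis openin_open)
  qed
  then obtain T where T: "\<And>v. open (T v)" "\<And>v. ?Q \<inter> T v = ?Q \<inter> H -` corner_star v"
    by metis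
  have cover: "?Q \<subseteq> \<Union> (T ` Pow {..<5})"
  proof
    fix y assume y: "y \<in> ?Q"
    then have "H y \<in> cube_surface" using assms(2) by blast
    then obtain v where "v \<subseteq> {..<5}" "H y \<in> corner_star v" by (rule in_some_star)
    with y T(2)[of v] show "y \<in> \<Union> (T ` Pow {..<5})" by blast
  qed
  obtain \<delta> where \<delta>: "0 < \<delta>" "\<And>B. B \<subseteq> ?Q \<Longrightarrow> diameter B < \<delta> \<Longrightarrow> \<exists>C\<in>T ` Pow {..<5}. B \<subseteq> C"
    by (rule Lebesgue_number_lemma[of ?Q "T ` Pow {..<5}"])
      (use T(1) cover in \<open>auto intro!: compact_Times\<close>)
  \<comment> \<open>a box of the grid has diameter at most \<open>1 / N + 1 / N\<close>\<close>
  obtain n :: nat where n: "2 / \<delta> < real n" using reals_Archimedean2 by blast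
  define N where "N = Suc n"
  have N: "0 < N" "2 / real N < \<delta>"
    using n \<delta>(1) by (auto simp: N_def field_simps intro: less_trans)
  show ?thesis
  proof
    fix i j assume ij: "i < N" "j < N"
    let ?I = "\<lambda>i. {real i / real N..real (Suc i) / real N}"
    have sub: "?I i \<subseteq> {0..1}" if "i < N" for i
      using that by (auto simp: divide_simps intro: order_trans)
    have "norm (x - y) \<le> 2 / real N" if "x \<in> ?I i \<times> ?I j" "y \<in> ?I i \<times> ?I j" for x y
    proof -
      have d: "real (Suc k) / real N - real k / real N = 1 / real N" for k
        by (simp add: diff_divide_distrib[symmetric])
      have "\<bar>fst x - fst y\<bar> \<le> 1 / real N" "\<bar>snd x - snd y\<bar> \<le> 1 / real N"
        using that d[of i] d[of j] by (auto simp: abs_if)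
      moreover have "norm (x - y) \<le> \<bar>fst x - fst y\<bar> + \<bar>snd x - snd y\<bar>"
        using norm_Pair_le[of "fst x - fst y" "snd x - snd y"] by (simp add: minus_prod_def)
      ultimately show ?thesis by simp
    qed
    then have "diameter (?I i \<times> ?I j) \<le> 2 / real N"
      by (intro diameter_le) auto
    moreover have "?I i \<times> ?I j \<subseteq> ?Q" using sub[OF ij(1)] sub[OF ij(2)] by blast
    ultimately obtain v where v: "v \<subseteq> {..<5}" "?I i \<times> ?I j \<subseteq> T v"
      using \<delta>(2)[of "?I i \<times> ?I j"] N by fastforce
    have "?I i \<times> ?I j \<subseteq> ?Q \<inter> T v" using v \<open>?I i \<times> ?I j \<subseteq> ?Q\<close> by blast
    then show "\<exists>v\<subseteq>{..<5}. \<forall>s\<in>?I i. \<forall>t\<in>?I j. H (s, t) \<in> corner_star v"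
      using v(1) unfolding T(2) by blast
  qed (use N in simp)
qed

lemma traces_exists:
  assumes "path p" "path_image p \<subseteq> cube_surface"
  obtains w where "traces p w"
proof -
  have "continuous_on ({0..1} \<times> {0..1}) (\<lambda>y :: real \<times> real. p (snd y))"
    using assms(1) unfolding path_def
    by (intro continuous_on_compose2[of "{0..1}" p _ snd] continuous_on_snd continuous_on_id) auto
  then obtain N where N: "0 < (N::nat)"
    "\<And>i j. i < N \<Longrightarrow> j < N \<Longrightarrow> \<exists>v\<subseteq>{..<5}.
       \<forall>s\<in>{real i / real N..real (Suc i) / real N}.
       \<forall>t\<in>{real j / real N..real (Suc j) / real N}. p (snd (s, t)) \<in> corner_star v"
    by (rule star_grid) (use assms(2) in \<open>auto simp: path_image_def\<close>)
  have "\<exists>v\<subseteq>{..<5}. \<forall>t\<in>{real j / real N..real (Suc j) / real N}. p t \<in> corner_star v" if "j < N" for j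
    using N(2)[OF N(1) that] N(1) by auto
  then obtain vs where "\<And>j. j < N \<Longrightarrow> vs j \<subseteq> {..<5}"
    "\<And>j t. j < N \<Longrightarrow> t \<in> {real j / real N..real (Suc j) / real N} \<Longrightarrow> p t \<in> corner_star (vs j)"
    by metis
  with N(1) have "subdivides p vs N" by (auto simp: subdivides_def)
  then show ?thesis using that by (auto simp: traces_def)
qed

text \<open>
  Neighbouring horizontal lines of the grid run through the same stars and hence have a common
  itinerary. So the traced word does not change from one line to the next.
\<close>

lemma traces_homotopic:
  assumes "homotopic_paths cube_surface p q" "p 0 = corner u" "p 1 = corner v" "u \<subseteq> {..<5}" "v \<subseteq> {..<5}"
    and "traces p w" "traces q w'"
  shows "w \<doteq> w'"
proof -
  obtain H :: "real \<times> real \<Rightarrow> nat \<Rightarrow> real" where H: "continuous_on ({0..1} \<times> {0..1}) H" "H ` ({0..1} \<times> {0..1}) \<subseteq> cube_surface"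
    "\<And>t. t \<in> {0..1} \<Longrightarrow> H (0, t) = p t" "\<And>t. t \<in> {0..1} \<Longrightarrow> H (1, t) = q t"
    "\<And>s. s \<in> {0..1} \<Longrightarrow> H (s, 0) = corner u" "\<And>s. s \<in> {0..1} \<Longrightarrow> H (s, 1) = corner v"
  proof -
    from assms(1) obtain h :: "real \<times> real \<Rightarrow> nat \<Rightarrow> real" where "continuous_on ({0..1} \<times> {0..1}) h"
      "h \<in> {0..1} \<times> {0..1} \<rightarrow> cube_surface"
      "\<And>t. t \<in> {0..1} \<Longrightarrow> h (0, t) = p t" "\<And>t. t \<in> {0..1} \<Longrightarrow> h (1, t) = q t"
      "\<And>s. s \<in> {0..1} \<Longrightarrow> pathstart (h \<circ> Pair s) = pathstart p"
      "\<And>s. s \<in> {0..1} \<Longrightarrow> pathfinish (h \<circ> Pair s) = pathfinish p"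
      unfolding homotopic_paths by metis
    with assms(2,3) show ?thesis
      by (intro that[of h]) (auto simp: pathstart_def pathfinish_def)
  qed
  obtain N where N: "0 < (N::nat)"
    "\<And>i j. i < N \<Longrightarrow> j < N \<Longrightarrow> \<exists>v\<subseteq>{..<5}.
       \<forall>s\<in>{real i / real N..real (Suc i) / real N}.
       \<forall>t\<in>{real j / real N..real (Suc j) / real N}. H (s, t) \<in> corner_star v"
    using star_grid[OF H(1,2)] by blast
  have ends: "H (real i / real N, 0) = corner u" "H (real i / real N, 1) = corner v" if "i \<le> N" for i
    using that N(1) H(5,6) by (auto simp: divide_simps)
  have cong: "traces r w \<Longrightarrow> traces r' w" if eq: "\<And>t. t \<in> {0..1} \<Longrightarrow> r t = r' t" for r r' w
  proof -
    assume "traces r w"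
    then obtain vs M where s: "subdivides r vs M" and w: "w = itinerary vs (M - 1)"
      by (auto simp: traces_def)
    have "r' t \<in> corner_star (vs i)" if i: "i < M" and t: "t \<in> {real i / real M..real (Suc i) / real M}" for i t
    proof -
      have "0 \<le> real i / real M" "real (Suc i) / real M \<le> 1" using i by (auto simp: divide_simps)
      with t have "0 \<le> t" "t \<le> 1" unfolding atLeastAtMost_iff by linarith+
      then have "r t = r' t" by (intro eq) simp
      moreover have "r t \<in> corner_star (vs i)" using subdividesD(2)[OF s i] t by simp
      ultimately show ?thesis by simp
    qed
    then have "subdivides r' vs M" using s by (auto simp: subdivides_def)
    with w show ?thesis by (auto simp: traces_def)
  qed
  have "\<forall>w'. traces (\<lambda>t. H (real i / real N, t)) w' \<longrightarrow> w \<doteq> w'" if "i \<le> N" for i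
    using that
  proof (induction i)
    case 0
    have "traces (\<lambda>t. H (real 0 / real N, t)) w"
      by (rule cong[OF _ assms(6)]) (simp add: H(3))
    then show ?case using traces_unique[OF _ _ ends[of 0] assms(4,5)] by blast
  next
    case (Suc i)
    then have i: "i < N" by simp
    have "\<exists>vs. \<forall>j<N. vs j \<subseteq> {..<5} \<and> (\<forall>s\<in>{real i / real N..real (Suc i) / real N}.
       \<forall>t\<in>{real j / real N..real (Suc j) / real N}. H (s, t) \<in> corner_star (vs j))"
      using N(2)[OF i] by metis
    then obtain vs where vs: "\<And>j. j < N \<Longrightarrow> vs j \<subseteq> {..<5}"
      "\<And>j s t. j < N \<Longrightarrow> s \<in> {real i / real N..real (Suc i) / real N} \<Longrightarrow>
         t \<in> {real j / real N..real (Suc j) / real N} \<Longrightarrow> H (s, t) \<in> corner_star (vs j)"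
      by metis
    have "real i / real N \<le> real (Suc i) / real N" by (simp add: divide_right_mono)
    then have "subdivides (\<lambda>t. H (real i / real N, t)) vs N" "subdivides (\<lambda>t. H (real (Suc i) / real N, t)) vs N"
      using vs N(1) by (auto simp: subdivides_def simp del: of_nat_Suc)
    then have c: "traces (\<lambda>t. H (real i / real N, t)) (itinerary vs (N - 1))"
      "traces (\<lambda>t. H (real (Suc i) / real N, t)) (itinerary vs (N - 1))"
      by (auto simp: traces_def)
    have "w \<doteq> itinerary vs (N - 1)" using Suc c(1) by simp
    then show ?case
      using traces_unique[OF c(2) _ ends[OF Suc.prems] assms(4,5)] weq.trans by blast
  qed
  from this[of N] have "traces (\<lambda>t. H (1, t)) w' \<longrightarrow> w \<doteq> w'" using N(1) by simp
  moreover have "traces (\<lambda>t. H (1, t)) w'"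
    by (rule cong[OF _ assms(7)]) (simp add: H(4))
  ultimately show ?thesis by simp
qed

lemma subdivides_join:
  assumes "subdivides p vs N" "subdivides q vs' N" "pathfinish p = pathstart q"
  shows "subdivides (p +++ q) (\<lambda>i. if i < N then vs i else vs' (i - N)) (2 * N)"
  unfolding subdivides_def
proof (intro conjI allI impI ballI)
  have N: "0 < N" using assms(1) by (simp add: subdivides_def)
  then show "0 < 2 * N" by simp
  fix i assume i: "i < 2 * N"
  show "(if i < N then vs i else vs' (i - N)) \<subseteq> {..<5}"
    using subdividesD(1)[OF assms(1), of i] subdividesD(1)[OF assms(2), of "i - N"] i by auto
  fix t assume t: "t \<in> {real i / real (2 * N)..real (Suc i) / real (2 * N)}"
  show "(p +++ q) t \<in> corner_star (if i < N then vs i else vs' (i - N))"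
  proof (cases "i < N")
    case True
    have "real i / real N \<le> 2 * t" "2 * t \<le> real (Suc i) / real N"
      using t N by (auto simp: divide_simps mult_ac)
    moreover from this(2) have "2 * t \<le> 1"
      by (rule order_trans) (use True in \<open>simp add: divide_simps\<close>)
    ultimately show ?thesis
      using True subdividesD(2)[OF assms(1) True, of "2 * t"] by (simp add: joinpaths_def mult.commute)
  next
    case False
    then have k: "i - N < N" and i_eq: "real (i - N) = real i - real N" using i by (auto simp: of_nat_diff)
    have "real (i - N) / real N \<le> 2 * t - 1" "2 * t - 1 \<le> real (Suc (i - N)) / real N"
      using t N by (auto simp: divide_simps algebra_simps i_eq)
    moreover have "(p +++ q) t = q (2 * t - 1)"
    proof (cases "t \<le> 1 / 2")
      case True
      have "1 / 2 \<le> real i / real (2 * N)" using False N by (simp add: divide_simps)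
      with t True have half: "t = 1 / 2" by simp
      show ?thesis using assms(3) unfolding half by (simp add: joinpaths_def pathfinish_def pathstart_def)
    qed (simp add: joinpaths_def)
    ultimately show ?thesis
      using False subdividesD(2)[OF assms(2) k, of "2 * t - 1"] by simp
  qed
qed

lemma itinerary_cong: "(\<And>i. i \<le> k \<Longrightarrow> vs i = vs' i) \<Longrightarrow> itinerary vs k = itinerary vs' k"
  by (induction k) auto

lemma traces_join:
  assumes "traces p w" "traces q w'" "pathfinish p = corner u" "pathstart q = corner u" "u \<subseteq> {..<5}"
  shows "traces (p +++ q) (w @ w')"
proof -
  obtain vs N vs' N' where s: "subdivides p vs N" "subdivides q vs' N'"
    and w: "w = itinerary vs (N - 1)" "w' = itinerary vs' (N' - 1)"
    using assms(1,2) by (auto simp: traces_def)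
  have pos: "0 < N" "0 < N'" using s by (auto simp: subdivides_def)
  \<comment> \<open>concatenation needs subdivisions with equally many pieces\<close>
  let ?M = "N * N'" and ?vs = "\<lambda>j. vs (j div N')" and ?vs' = "\<lambda>j. vs' (j div N)"
  have r: "subdivides p ?vs ?M" "subdivides q ?vs' ?M"
    using subdivides_refine[OF s(1) pos(2)] subdivides_refine[OF s(2) pos(1)] by (simp_all add: mult.commute)
  obtain K where K: "?M = Suc K" using pos gr0_implies_Suc[of ?M] by auto
  let ?c = "\<lambda>i. if i < ?M then ?vs i else ?vs' (i - ?M)"
  have mid: "?vs K = u" "?vs' 0 = u"
    using subdivides_last[OF r(1) _ assms(5)] subdivides_first[OF r(2) _ assms(5)] assms(3,4) K
    by (auto simp: pathfinish_def pathstart_def)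
  have first: "itinerary ?c K = itinerary ?vs K"
    using K by (intro itinerary_cong) auto
  have "itinerary ?c (?M + k) = itinerary ?vs K @ itinerary ?vs' k" for k
  proof (induction k)
    case 0
    show ?case using first mid K by simp
  next
    case (Suc k)
    then show ?case by simp
  qed
  from this[of K] have "itinerary ?c (2 * ?M - 1) = itinerary ?vs K @ itinerary ?vs' K"
    using K by (simp add: mult_2)
  moreover have "K div N' = N - 1" "K div N = N' - 1"
    using pred_mult_div[OF pos] pred_mult_div[OF pos(2,1)] K by (simp_all add: mult.commute)
  then have "itinerary ?vs K = w" "itinerary ?vs' K = w'"
    unfolding w itinerary_refine[OF pos(2)] itinerary_refine[OF pos(1)] by auto
  moreover have "subdivides (p +++ q) ?c (2 * ?M)"
    using assms(3,4) by (intro subdivides_join r) simp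
  ultimately show ?thesis
    unfolding traces_def by (intro exI[of _ ?c] exI[of _ "2 * ?M"]) simp
qed

section \<open>Deforming paths to edge paths\<close>

text \<open>
  The part of a path between two parameters, reparametrized to the unit interval.
\<close>

definition portion :: "real \<Rightarrow> real \<Rightarrow> (real \<Rightarrow> 'a) \<Rightarrow> real \<Rightarrow> 'a"
  where "portion a b p = p \<circ> subpath a b id"

lemma portion_ends [simp]:
  "pathstart (portion a b p) = p a" "pathfinish (portion a b p) = p b"
  by (simp_all add: portion_def pathstart_def pathfinish_def subpath_def)

lemma portion_whole [simp]: "portion 0 1 p = p"
  by (simp add: portion_def subpath_def comp_def)

lemma path_image_portion:
  assumes "a \<le> b"
  shows "path_image (portion a b p) = p ` {a..b}"
  using assms by (simp add: portion_def path_image_compose path_image_subpath)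

lemma path_portion:
  fixes p :: "real \<Rightarrow> 'a::topological_space"
  assumes "path p" "0 \<le> a" "a \<le> b" "b \<le> 1"
  shows "path (portion a b p)"
proof -
  have id: "path (id :: real \<Rightarrow> real)" by (simp add: path_def continuous_on_id)
  have "path (subpath a b (id :: real \<Rightarrow> real))"
    by (rule path_subpath[OF id]) (use assms in auto)
  moreover have "path_image (subpath a b (id :: real \<Rightarrow> real)) \<subseteq> {0..1}"
    using path_image_subpath[of a b "id :: real \<Rightarrow> real"] assms by auto
  then have "continuous_on (path_image (subpath a b (id :: real \<Rightarrow> real))) p"
    using assms(1) continuous_on_subset unfolding path_def by blast
  ultimately show ?thesis unfolding portion_def by (rule path_continuous_image)
qed

lemma portion_split:
  fixes p :: "real \<Rightarrow> 'a::topological_space"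
  assumes "path p" "path_image p \<subseteq> S" "0 \<le> a" "a \<le> b" "b \<le> c" "c \<le> 1"
  shows "homotopic_paths S (portion a b p +++ portion b c p) (portion a c p)"
proof -
  let ?id = "id :: real \<Rightarrow> real"
  have "homotopic_paths {0..1} (subpath a b ?id +++ subpath b c ?id) (subpath a c ?id)"
    by (rule homotopic_join_subpaths1)
      (use assms in \<open>auto simp: path_def path_image_def continuous_on_id\<close>)
  then have "homotopic_paths S (p \<circ> (subpath a b ?id +++ subpath b c ?id)) (p \<circ> subpath a c ?id)"
    by (rule homotopic_paths_continuous_image)
      (use assms(1,2) in \<open>auto simp: path_def path_image_def\<close>)
  then show ?thesis by (simp add: portion_def path_compose_join)
qed

lemma segment_to_corner_in_star:
  assumes "x \<in> corner_star v" "v \<subseteq> {..<5}"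
  shows "path_image (segment x (corner v)) \<subseteq> corner_star v"
proof -
  obtain A i where Ai: "A \<subseteq> {..<5}" "i < 5" "x \<in> face A i" "corner v \<in> face A i"
    using face_stars[OF assms] assms by metis
  have "segment x (corner v) t \<in> corner_star v" if t: "t \<in> {0..1}" for t
  proof -
    have "\<bar>segment x (corner v) t j - corner v j\<bar> < 1" if "j < 5" for j
    proof -
      have "segment x (corner v) t j - corner v j = (1 - t) * (x j - corner v j)"
        by (simp add: segment_def algebra_simps)
      then have "\<bar>segment x (corner v) t j - corner v j\<bar> = (1 - t) * \<bar>x j - corner v j\<bar>"
        using t by (simp add: abs_mult)
      also have "\<dots> \<le> 1 * \<bar>x j - corner v j\<bar>"
        using t by (intro mult_right_mono) auto
      also have "\<dots> < 1" using assms(1) that by (simp add: corner_star_def)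
      finally show ?thesis .
    qed
    moreover have "segment x (corner v) t \<in> cube_surface"
      using segment_in_face[OF Ai(3,4) t] face_subset[OF Ai(1,2)] by blast
    ultimately show ?thesis by (simp add: corner_star_def)
  qed
  then show ?thesis by (auto simp: path_image_def)
qed

lemma star_subset: "corner_star v \<subseteq> cube_surface"
  by (auto simp: corner_star_def)

text \<open>
  A point in two stars and the two corners lie on a common square, which is convex.
\<close>

lemma segment_change_corner:
  assumes "x \<in> corner_star u" "x \<in> corner_star v" "u \<subseteq> {..<5}" "v \<subseteq> {..<5}"
  shows "homotopic_paths cube_surface (segment x (corner v)) (segment x (corner u) +++ epath u (word_between u v))"
proof -
  obtain A i where Ai: "A \<subseteq> {..<5}" "i < 5" "x \<in> face A i"
    and c: "corner u \<in> face A i" "corner v \<in> face A i"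
    using face_stars[OF assms(1,3)] assms by metis
  show ?thesis
    using path_image_segment_face[OF Ai(3) c(1)] path_image_segment_face[OF Ai(3) c(2)]
      path_image_epath_face[OF c(1) word_between_letters_in_face[OF c]] fold_flip_word_between[OF assms(3,4)]
    by (intro homotopic_in_face[OF Ai(1,2)]) (auto simp: path_image_join)
qed

text \<open>
  By induction along the subdivision: an initial portion of the path, closed up by a segment to the
  corner of the star that it ends in, is homotopic to the edge path of its itinerary. In the
  induction step the next portion is first contracted inside its star, and then the segment to the
  new corner is replaced by the one to the old corner followed by an edge path.
\<close>

lemma subdivided_path_homotopic:
  assumes s: "subdivides p vs N" and p: "path p" "path_image p \<subseteq> cube_surface"
    and start: "p 0 = corner (vs 0)" and "k < N"
  shows "homotopic_paths cube_surface
    (portion 0 (real (Suc k) / real N) p +++ segment (p (real (Suc k) / real N)) (corner (vs k)))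
    (epath (vs 0) (itinerary vs k))"
  using assms(5)
proof (induction k)
  case 0
  let ?t = "real (Suc 0) / real N"
  have t: "0 \<le> ?t" "?t \<le> 1" using 0 by (auto simp: divide_simps)
  note v = subdividesD[OF s 0]
  have im: "path_image (portion 0 ?t p) \<subseteq> corner_star (vs 0)"
    using v(2) t by (auto simp: path_image_portion)
  have "p ?t \<in> corner_star (vs 0)" using v(2)[of ?t] by simp
  then have "path_image (segment (p ?t) (corner (vs 0))) \<subseteq> corner_star (vs 0)"
    by (rule segment_to_corner_in_star[OF _ v(1)])
  then show ?case
    using im t p v(1) start
    by (intro homotopic_in_star[OF v(1)]) (auto simp: path_image_join path_portion corner_in_star)
next
  case (Suc k)
  then have k: "k < N" by simp
  define a b where "a = real (Suc k) / real N" and "b = real (Suc (Suc k)) / real N"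
  have ab: "0 \<le> a" "a \<le> b" "b \<le> 1" "real k / real N \<le> a"
    using Suc.prems by (auto simp: a_def b_def divide_simps)
  let ?u = "vs k" and ?v = "vs (Suc k)"
  note u = subdividesD[OF s k, folded a_def] and v = subdividesD[OF s Suc.prems, folded a_def b_def]
  have x: "p a \<in> corner_star ?u" "p a \<in> corner_star ?v" "p b \<in> corner_star ?v"
    using u(2)[of a] v(2)[of a] v(2)[of b] ab by auto
  have "p t \<in> cube_surface" if "0 \<le> t" "t \<le> 1" for t
    using p(2) that by (auto simp: path_image_def)
  then have im: "path_image (portion 0 a p) \<subseteq> cube_surface" "path_image (portion a b p) \<subseteq> corner_star ?v"
    "path_image (portion 0 b p) \<subseteq> cube_surface"
    using v(2) ab by (auto simp: path_image_portion)
  note pp = path_portion[OF p(1), of 0 a] path_portion[OF p(1), of a b] path_portion[OF p(1), of 0 b]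
  have segs: "path_image (segment (p a) (corner ?u)) \<subseteq> cube_surface" "path_image (segment (p a) (corner ?v)) \<subseteq> corner_star ?v"
     "path_image (segment (p b) (corner ?v)) \<subseteq> corner_star ?v"
    using segment_to_corner_in_star[OF x(1) u(1)] segment_to_corner_in_star[OF x(2) v(1)]
      segment_to_corner_in_star[OF x(3) v(1)] star_subset by blast+
  have e: "path_image (epath ?u (word_between ?u ?v)) \<subseteq> cube_surface"
    by (intro path_image_epath u(1)) (auto simp: set_word_between)
  have "homotopic_paths cube_surface (portion 0 b p +++ segment (p b) (corner ?v))
      ((portion 0 a p +++ portion a b p) +++ segment (p b) (corner ?v))"
    using segs(3) star_subset[of ?v] ab p
    by (intro homotopic_paths_join homotopic_paths_sym[OF portion_split]) auto
  also have "homotopic_paths cube_surface \<dots>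
      (portion 0 a p +++ (portion a b p +++ segment (p b) (corner ?v)))"
    using im segs(3) star_subset[of ?v] ab pp
    by (intro homotopic_paths_sym[OF homotopic_paths_assoc]) auto
  also have "homotopic_paths cube_surface \<dots> (portion 0 a p +++ segment (p a) (corner ?v))"
    using im segs ab pp
    by (intro homotopic_paths_join[OF _ homotopic_in_star[OF v(1)]]) (auto simp: path_image_join)
  also have "homotopic_paths cube_surface \<dots>
      (portion 0 a p +++ (segment (p a) (corner ?u) +++ epath ?u (word_between ?u ?v)))"
    using im ab pp
    by (intro homotopic_paths_join segment_change_corner x u(1) v(1)) auto
  also have "homotopic_paths cube_surface \<dots>
      ((portion 0 a p +++ segment (p a) (corner ?u)) +++ epath ?u (word_between ?u ?v))"
    using im segs e ab pp by (intro homotopic_paths_assoc) auto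
  also have "homotopic_paths cube_surface \<dots> (epath (vs 0) (itinerary vs k) +++ epath ?u (word_between ?u ?v))"
    using Suc.IH[OF k] e by (intro homotopic_paths_join) (auto simp: a_def)
  also have "homotopic_paths cube_surface \<dots> (epath (vs 0) (itinerary vs (Suc k)))"
  proof -
    have "fold flip (itinerary vs k) (vs 0) = ?u"
    proof -
      have "j < N \<Longrightarrow> fold flip (itinerary vs j) (vs 0) = vs j" for j
        by (induction j) (use subdividesD(1)[OF s] in \<open>auto simp: fold_flip_word_between\<close>)
      then show ?thesis using k by blast
    qed
    then show ?thesis
      using epath_append[of "vs 0" "itinerary vs k" "word_between ?u ?v"] subdividesD(1)[OF s, of 0] k set_itinerary
      by (auto simp: set_word_between subset_iff)
  qed
  finally show ?case by (simp add: a_def b_def)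
qed

lemma traces_homotopic_epath:
  assumes "traces p w" "path p" "path_image p \<subseteq> cube_surface"
    "p 0 = corner u" "p 1 = corner v" "u \<subseteq> {..<5}" "v \<subseteq> {..<5}"
  shows "homotopic_paths cube_surface p (epath u w)"
proof -
  obtain vs N where s: "subdivides p vs N" and w: "w = itinerary vs (N - 1)"
    using assms(1) by (auto simp: traces_def)
  have N: "0 < N" "N - 1 < N" "real (Suc (N - 1)) / real N = 1"
    using s by (auto simp: subdivides_def)
  have ends: "vs 0 = u" "vs (N - 1) = v"
    using subdivides_first[OF s assms(4,6)] subdivides_last[OF s assms(5,7)] by auto
  have "segment (corner v) (corner v) = (\<lambda>_. corner v)"
    by (auto simp: segment_def fun_eq_iff algebra_simps)
  then have "homotopic_paths cube_surface (p +++ (\<lambda>_. corner v)) (epath u w)"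
    using subdivided_path_homotopic[OF s assms(2,3) _ N(2), unfolded N(3) ends assms(5)] assms(4) w
    by simp
  moreover have "homotopic_paths cube_surface p (p +++ (\<lambda>_. corner v))"
    using assms by (intro homotopic_paths_sym[OF homotopic_join_const]) (auto simp: pathfinish_def)
  ultimately show ?thesis using homotopic_paths_trans by blast
qed

lemma traces_letters: "traces p w \<Longrightarrow> set w \<subseteq> {..<5}"
  using set_itinerary by (auto simp: traces_def)

section \<open>A triangulation\<close>

abbreviation pairs :: "(nat \<times> nat) set"
  where "pairs \<equiv> {(p, q). adj p q}"

text \<open>
  Each square is cut along the diagonal from its smallest to its largest corner. The triangles are
  then the chains \<open>A \<subset> A \<union> {p} \<subset> A \<union> {p, q}\<close> with consecutive directions \<open>p, q\<close> outside \<open>A\<close>.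
\<close>

definition kuhn_triangle :: "nat set \<Rightarrow> nat \<Rightarrow> nat \<Rightarrow> nat set set"
  where "kuhn_triangle A p q = {A, insert p A, insert q (insert p A)}"

definition triangle_at :: "nat set \<Rightarrow> nat \<Rightarrow> nat \<Rightarrow> bool"
  where "triangle_at A p q \<longleftrightarrow> adj p q \<and> A \<subseteq> {..<5} - {p, q}"

definition simplices :: "nat set set set"
  where "simplices = {\<sigma>. \<sigma> \<noteq> {} \<and> (\<exists>A p q. triangle_at A p q \<and> \<sigma> \<subseteq> kuhn_triangle A p q)}"

text \<open>
  Corners are numbered by \<open>set_encode\<close>, since vertices of complexes are natural numbers.
\<close>

definition surface_complex :: "nat set set"
  where "surface_complex = (`) set_encode ` simplices"

lemma triangle_atD:
  assumes "triangle_at A p q"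
  shows "adj p q" "A \<subseteq> {..<5}" "p \<notin> A" "q \<notin> A" "p < 5" "q < 5" "p \<noteq> q" "finite A"
  using assms adj_less adj_irrefl by (auto simp: triangle_at_def intro: finite_subset)

lemma simplex_subset:
  assumes "\<sigma> \<in> simplices"
  shows "\<sigma> \<subseteq> Pow {..<5}"
proof -
  obtain A p q where T: "triangle_at A p q" "\<sigma> \<subseteq> kuhn_triangle A p q"
    using assms by (auto simp: simplices_def)
  have "kuhn_triangle A p q \<subseteq> Pow {..<5}"
    using triangle_atD[OF T(1)] by (simp add: kuhn_triangle_def)
  with T(2) show ?thesis by (rule subset_trans)
qed

declare set_encode_insert [simp del]

lemma finite_corner_set: "B \<subseteq> {..<5 :: nat} \<Longrightarrow> finite B"
  by (rule finite_subset) auto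

lemma encode_eq_iff: "A \<subseteq> {..<5} \<Longrightarrow> B \<subseteq> {..<5} \<Longrightarrow> set_encode A = set_encode B \<longleftrightarrow> A = B"
  by (intro set_encode_eq finite_corner_set)

lemma inj_on_encode: "inj_on set_encode (Pow {..<5})"
  by (auto simp: inj_on_def encode_eq_iff)

lemma finite_simplices: "finite simplices"
  by (rule finite_subset[of _ "Pow (Pow {..<5})"]) (use simplex_subset in auto)

lemma complex_simplicial: "finite_simplicial_complex surface_complex"
  unfolding finite_simplicial_complex_def
proof (intro conjI ballI allI impI)
  show "finite surface_complex" by (simp add: surface_complex_def finite_simplices)
  fix \<sigma> assume "\<sigma> \<in> surface_complex"
  then obtain \<rho> where r: "\<rho> \<in> simplices" "\<sigma> = set_encode ` \<rho>" by (auto simp: surface_complex_def)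
  have "finite \<rho>" by (rule finite_subset[OF simplex_subset[OF r(1)]]) auto
  then show "finite \<sigma>" "\<sigma> \<noteq> {}" using r by (auto simp: simplices_def)
  fix \<tau> assume t: "\<tau> \<subseteq> \<sigma> \<and> \<tau> \<noteq> {}"
  then have "\<tau> \<subseteq> set_encode ` \<rho>" using r(2) by simp
  then obtain \<rho>' where r': "\<rho>' \<subseteq> \<rho>" "\<tau> = set_encode ` \<rho>'"
    by (rule subset_imageE)
  obtain A p q where "triangle_at A p q" "\<rho> \<subseteq> kuhn_triangle A p q"
    using r(1) unfolding simplices_def by blast
  moreover have "\<rho>' \<noteq> {}" using r' t by blast
  ultimately have "\<rho>' \<in> simplices"
    using r'(1) unfolding simplices_def by blast
  then show "\<tau> \<in> surface_complex" unfolding surface_complex_def r'(2) by (rule imageI)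
qed

text \<open>
  A triangle is parametrized by the values \<open>s \<ge> r\<close> of the coordinates in the directions \<open>p\<close> and
  \<open>q\<close>. The barycentric coordinates of the point are the successive differences of \<open>1 \<ge> s \<ge> r \<ge> 0\<close>,
  and \<open>kuhn_point\<close> is the point of the cube.
\<close>

definition barycentric :: "nat set \<Rightarrow> nat \<Rightarrow> nat \<Rightarrow> real \<times> real \<Rightarrow> nat \<Rightarrow> real"
  where "barycentric A p q = (\<lambda>(s, r) k.
    if k = set_encode A then 1 - s else if k = set_encode (insert p A) then s - r
    else if k = set_encode (insert q (insert p A)) then r else 0)"

definition kuhn_point :: "nat set \<Rightarrow> nat \<Rightarrow> nat \<Rightarrow> real \<times> real \<Rightarrow> nat \<Rightarrow> real"
  where "kuhn_point A p q = (\<lambda>(s, r) j. if j \<in> A then 1 else if j = p then s else if j = q then r else 0)"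

definition kuhn_params :: "(real \<times> real) set"
  where "kuhn_params = {(s, r). 0 \<le> r \<and> r \<le> s \<and> s \<le> 1}"

lemma triangle_codes:
  assumes "triangle_at A p q"
  shows "set_encode A \<noteq> set_encode (insert p A)"
    "set_encode A \<noteq> set_encode (insert q (insert p A))"
    "set_encode (insert p A) \<noteq> set_encode (insert q (insert p A))"
  using triangle_atD[OF assms] by (subst encode_eq_iff; auto)+

lemma realization_complex:
  "realization surface_complex = (\<Union>(A, p, q)\<in>{(A, p, q). triangle_at A p q}. barycentric A p q ` kuhn_params)"
proof (intro equalityI subsetI)
  fix t assume t: "t \<in> realization surface_complex"
  then have nonneg: "\<And>i. 0 \<le> t i" and "{i. t i \<noteq> 0} \<in> surface_complex" and sum: "(\<Sum>i | t i \<noteq> 0. t i) = 1"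
    by (auto simp: realization_def)
  then obtain \<rho> where "\<rho> \<in> simplices" and \<rho>: "{i. t i \<noteq> 0} = set_encode ` \<rho>"
    unfolding surface_complex_def by (rule_tac imageE) auto
  then obtain A p q where T: "triangle_at A p q" and "\<rho> \<subseteq> kuhn_triangle A p q"
    unfolding simplices_def by blast
  then have supp: "{i. t i \<noteq> 0} \<subseteq> set_encode ` kuhn_triangle A p q"
    unfolding \<rho> by (intro image_mono)
  let ?a = "set_encode A" and ?b = "set_encode (insert p A)" and ?c = "set_encode (insert q (insert p A))"
  have supp: "{i. t i \<noteq> 0} \<subseteq> {?a, ?b, ?c}" using supp by (auto simp: kuhn_triangle_def)
  have "(\<Sum>i | t i \<noteq> 0. t i) = (\<Sum>i\<in>{?a, ?b, ?c}. t i)"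
    by (rule sum.mono_neutral_left) (use supp in auto)
  then have abc: "t ?a + t ?b + t ?c = 1"
    using sum triangle_codes[OF T] by simp
  have "t = barycentric A p q (t ?b + t ?c, t ?c)"
    using abc supp triangle_codes[OF T] by (auto simp: barycentric_def fun_eq_iff subset_iff)
  moreover have "(t ?b + t ?c, t ?c) \<in> kuhn_params"
    using abc nonneg[of ?a] nonneg[of ?b] nonneg[of ?c] by (auto simp: kuhn_params_def)
  ultimately show "t \<in> (\<Union>(A, p, q)\<in>{(A, p, q). triangle_at A p q}. barycentric A p q ` kuhn_params)"
    using T by auto
next
  fix t assume "t \<in> (\<Union>(A, p, q)\<in>{(A, p, q). triangle_at A p q}. barycentric A p q ` kuhn_params)"
  then obtain A p q s r where T: "triangle_at A p q" and w: "0 \<le> r" "r \<le> s" "s \<le> 1"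
    and t: "t = barycentric A p q (s, r)"
    by (auto simp: kuhn_params_def)
  let ?a = "set_encode A" and ?b = "set_encode (insert p A)" and ?c = "set_encode (insert q (insert p A))"
  have supp: "{i. t i \<noteq> 0} \<subseteq> {?a, ?b, ?c}" by (auto simp: t barycentric_def)
  have "(\<Sum>i | t i \<noteq> 0. t i) = (\<Sum>i\<in>{?a, ?b, ?c}. t i)"
    by (rule sum.mono_neutral_left) (use supp in auto)
  also have "\<dots> = 1"
    using triangle_codes[OF T] by (simp add: t barycentric_def)
  finally have sum: "(\<Sum>i | t i \<noteq> 0. t i) = 1" .
  then have "{i. t i \<noteq> 0} \<noteq> {}" by force
  moreover have "{i. t i \<noteq> 0} \<subseteq> set_encode ` kuhn_triangle A p q"
    using supp by (auto simp: kuhn_triangle_def)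
  then obtain \<rho> where \<rho>: "\<rho> \<subseteq> kuhn_triangle A p q" "{i. t i \<noteq> 0} = set_encode ` \<rho>"
    by (rule subset_imageE)
  ultimately have "\<rho> \<in> simplices"
    using T by (auto simp: simplices_def)
  then have "{i. t i \<noteq> 0} \<in> surface_complex"
    unfolding surface_complex_def \<rho>(2) by (rule imageI)
  moreover have "0 \<le> t i" for i using w by (auto simp: t barycentric_def)
  ultimately show "t \<in> realization surface_complex" using sum by (simp add: realization_def)
qed

lemma finite_triangles: "finite {(A, p, q). triangle_at A p q}"
  by (rule finite_subset[of _ "Pow {..<5} \<times> {..<5} \<times> {..<5}"]) (auto dest: triangle_atD)

lemma compact_kuhn_params: "compact kuhn_params"
proof -
  have "kuhn_params = ({0..1} \<times> {0..1}) \<inter> {z. snd z \<le> fst z}"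
    by (auto simp: kuhn_params_def)
  moreover have "closed {z :: real \<times> real. snd z \<le> fst z}"
    by (intro closed_Collect_le continuous_intros)
  ultimately show ?thesis
    using compact_Int_closed[OF compact_Times[OF compact_Icc compact_Icc]] by metis
qed

lemma compact_realization: "compact (realization surface_complex)"
proof -
  have "continuous_on kuhn_params (barycentric A p q)" for A p q
    unfolding barycentric_def case_prod_unfold
  proof (rule continuous_on_coordinatewise_then_product)
    fix k
    show "continuous_on kuhn_params (\<lambda>z :: real \<times> real. if k = set_encode A then 1 - fst z
       else if k = set_encode (insert p A) then fst z - snd z
       else if k = set_encode (insert q (insert p A)) then snd z else 0)"
      by (cases "k = set_encode A"; cases "k = set_encode (insert p A)";
          cases "k = set_encode (insert q (insert p A))") (auto intro!: continuous_intros)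
  qed
  then show ?thesis
    unfolding realization_complex using finite_triangles compact_kuhn_params
    by (intro compact_UN) (auto intro: compact_continuous_image)
qed

definition to_cube :: "(nat \<Rightarrow> real) \<Rightarrow> nat \<Rightarrow> real"
  where "to_cube t j = (\<Sum>B\<in>Pow {..<5}. t (set_encode B) * corner B j)"

lemma to_cube_barycentric:
  assumes T: "triangle_at A p q"
  shows "to_cube (barycentric A p q z) = kuhn_point A p q z"
proof
  fix j
  obtain s r where z: "z = (s, r)" by (cases z)
  note d = triangle_atD[OF T]
  let ?t = "barycentric A p q z"
  have "to_cube ?t j = (\<Sum>B\<in>kuhn_triangle A p q. ?t (set_encode B) * corner B j)"
    unfolding to_cube_def
  proof (rule sum.mono_neutral_right)
    show "kuhn_triangle A p q \<subseteq> Pow {..<5}" using d by (simp add: kuhn_triangle_def)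
    show "\<forall>B\<in>Pow {..<5} - kuhn_triangle A p q. ?t (set_encode B) * corner B j = 0"
      using d by (simp add: kuhn_triangle_def barycentric_def z encode_eq_iff)
  qed simp
  also have "\<dots> = ?t (set_encode A) * corner A j + ?t (set_encode (insert p A)) * corner (insert p A) j
      + ?t (set_encode (insert q (insert p A))) * corner (insert q (insert p A)) j"
  proof -
    have "A \<noteq> insert p A" "A \<noteq> insert q (insert p A)" "insert p A \<noteq> insert q (insert p A)"
      using d by auto
    then show ?thesis by (simp add: kuhn_triangle_def)
  qed
  also have "\<dots> = kuhn_point A p q z j"
    using triangle_codes[OF T] d by (auto simp: barycentric_def kuhn_point_def z corner_def)
  finally show "to_cube ?t j = kuhn_point A p q z j" .
qed

text \<open>
  The barycentric coordinate at the corner \<open>B\<close> of a point \<open>x\<close> of the cube: the measure of the set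
  of thresholds \<open>\<theta>\<close> with \<open>{j. x j \<ge> \<theta>} = B\<close>. As it refers to no triangle, it shows that
  barycentric coordinates are determined by the point.
\<close>

definition depth :: "(nat \<Rightarrow> real) \<Rightarrow> nat set \<Rightarrow> real"
  where "depth x B = max 0 (Min (insert 1 (x ` B)) - Max (insert 0 (x ` ({..<5} - B))))"

lemma depth_kuhn_point:
  assumes T: "triangle_at A p q" and w: "z \<in> kuhn_params" and B: "B \<subseteq> {..<5}"
  shows "depth (kuhn_point A p q z) B = barycentric A p q z (set_encode B)"
proof -
  obtain s r where z: "z = (s, r)" and sr: "0 \<le> r" "r \<le> s" "s \<le> 1"
    using w by (auto simp: kuhn_params_def)
  note d = triangle_atD[OF T] and c = triangle_codes[OF T]
  let ?x = "kuhn_point A p q z" and ?m = "Min (insert 1 (kuhn_point A p q z ` B))"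
    and ?M = "Max (insert 0 (kuhn_point A p q z ` ({..<5} - B)))"
  have fin: "finite B" using B by (rule finite_corner_set)
  have le: "?m \<le> ?x j" if "j \<in> B" for j using that fin by simp
  have ge: "?x j \<le> ?M" if "j < 5" "j \<notin> B" for j using that by simp
  have M0: "0 \<le> ?M" and m1: "?m \<le> 1" using fin by simp_all
  consider "B = A" | "B = insert p A" | "B = insert q (insert p A)"
    | "B \<noteq> A" "B \<noteq> insert p A" "B \<noteq> insert q (insert p A)" by blast
  then show ?thesis
  proof cases
    case 1
    have "?m = 1" using fin by (intro Min_eqI) (auto simp: 1 kuhn_point_def z)
    moreover have "?M = s"
      by (rule Max_eqI) (use d sr in \<open>auto simp: 1 kuhn_point_def z image_iff intro!: bexI[of _ p]\<close>)
    ultimately show ?thesis using sr by (simp add: depth_def 1 barycentric_def z)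
  next
    case 2
    have "?m = s" using fin by (intro Min_eqI) (use d sr in \<open>auto simp: 2 kuhn_point_def z\<close>)
    moreover have "?M = r"
      by (rule Max_eqI) (use d sr in \<open>auto simp: 2 kuhn_point_def z image_iff intro!: bexI[of _ q]\<close>)
    ultimately show ?thesis using sr c by (simp add: depth_def 2 barycentric_def z)
  next
    case 3
    have "?m = r" using fin by (intro Min_eqI) (use d sr in \<open>auto simp: 3 kuhn_point_def z\<close>)
    moreover have "?M = 0"
      by (rule Max_eqI) (use d sr in \<open>auto simp: 3 kuhn_point_def z\<close>)
    ultimately show ?thesis using sr c by (simp add: depth_def 3 barycentric_def z)
  next
    case 4
    have "?m \<le> ?M"
    proof (cases "\<exists>j\<in>B. j \<notin> A \<and> j \<noteq> p \<and> j \<noteq> q")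
      case True
      then obtain j where "j \<in> B" "?x j = 0" by (auto simp: kuhn_point_def z)
      then show ?thesis using le[of j] M0 by linarith
    next
      case sub: False
      show ?thesis
      proof (cases "A \<subseteq> B")
        case False
        then obtain j where "j \<in> A" "j \<notin> B" by blast
        then have "?x j = 1" "j < 5" using d by (auto simp: kuhn_point_def z)
        then show ?thesis using ge[of j] m1 \<open>j \<notin> B\<close> by linarith
      next
        case True
        with sub 4 have "q \<in> B" "p \<notin> B" by blast+
        moreover have "?x q \<le> ?x p" using d sr by (simp add: kuhn_point_def z)
        ultimately show ?thesis using le[of q] ge[of p] d(5) by linarith
      qed
    qed
    moreover have "set_encode B \<notin> {set_encode A, set_encode (insert p A), set_encode (insert q (insert p A))}"
      using 4 B d by (simp add: encode_eq_iff)
    ultimately show ?thesis by (simp add: depth_def barycentric_def z)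
  qed
qed

lemma face_eq_kuhn_point:
  assumes "x \<in> face u i" "u \<subseteq> {..<5}" "i < 5"
  obtains A p q z where "triangle_at A p q" "z \<in> kuhn_params" "x = kuhn_point A p q z"
proof -
  let ?j = "Suc i mod 5"
  have adj: "adj i ?j" "adj ?j i" using assms(3) by (auto simp: adj_def)
  define A where "A = u - {i, ?j}"
  have A: "triangle_at A i ?j" "triangle_at A ?j i"
    using adj assms(2) by (auto simp: triangle_at_def A_def)
  have x: "x k = (if k \<in> A then 1 else 0)" if "k \<noteq> i" "k \<noteq> ?j" for k
    using faceD(3)[OF assms(1) that] that by (simp add: A_def corner_def)
  have b: "0 \<le> x k" "x k \<le> 1" for k using faceD(1,2)[OF assms(1)] by auto
  show ?thesis
  proof (cases "x ?j \<le> x i")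
    case True
    have "x = kuhn_point A i ?j (x i, x ?j)"
      using x by (auto simp: kuhn_point_def fun_eq_iff A_def)
    moreover have "(x i, x ?j) \<in> kuhn_params"
      using True b[of i] b[of ?j] by (simp add: kuhn_params_def)
    ultimately show ?thesis using that[OF A(1)] by blast
  next
    case False
    have "x = kuhn_point A ?j i (x ?j, x i)"
      using x by (auto simp: kuhn_point_def fun_eq_iff A_def)
    moreover have "(x ?j, x i) \<in> kuhn_params"
      using False b[of i] b[of ?j] by (simp add: kuhn_params_def)
    ultimately show ?thesis using that[OF A(2)] by blast
  qed
qed

lemma kuhn_point_in_surface:
  assumes T: "triangle_at A p q" and w: "z \<in> kuhn_params"
  shows "kuhn_point A p q z \<in> cube_surface"
proof -
  note d = triangle_atD[OF T]
  obtain i where i: "i < 5" "p = i \<and> q = Suc i mod 5 \<or> q = i \<and> p = Suc i mod 5"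
    using d(1) unfolding adj_def by blast
  have "kuhn_point A p q z \<in> face A i"
    using w i(2) d by (cases z) (auto simp: face_def kuhn_point_def kuhn_params_def corner_def)
  then show ?thesis using face_subset[OF d(2) i(1)] by blast
qed

lemma realization_homeomorphic: "realization surface_complex homeomorphic cube_surface"
proof (rule homeomorphic_compact[OF compact_realization])
  show "continuous_on (realization surface_complex) to_cube"
    unfolding to_cube_def
    by (intro continuous_on_coordinatewise_then_product continuous_intros
        continuous_on_subset[OF continuous_on_product_coordinates]) auto
  show "to_cube ` realization surface_complex = cube_surface"
  proof (intro equalityI subsetI)
    fix x assume "x \<in> to_cube ` realization surface_complex"
    then show "x \<in> cube_surface"
      unfolding realization_complex using to_cube_barycentric kuhn_point_in_surface by fastforce
  next
    fix x assume "x \<in> cube_surface"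
    then obtain u i where "u \<subseteq> {..<5}" "i < 5" "x \<in> face u i" by (rule cube_surfaceE)
    then obtain A p q z where T: "triangle_at A p q" "z \<in> kuhn_params" "x = kuhn_point A p q z"
      using face_eq_kuhn_point by metis
    then have "x = to_cube (barycentric A p q z)" using to_cube_barycentric by simp
    moreover have "barycentric A p q z \<in> realization surface_complex"
      unfolding realization_complex using T by auto
    ultimately show "x \<in> to_cube ` realization surface_complex" by blast
  qed
  show "inj_on to_cube (realization surface_complex)"
  proof (rule inj_onI, rule ext)
    fix t t' k
    assume "t \<in> realization surface_complex" "t' \<in> realization surface_complex" and eq: "to_cube t = to_cube t'"
    then obtain A p q z A' p' q' z' where
      T: "triangle_at A p q" "z \<in> kuhn_params" "t = barycentric A p q z"
      and T': "triangle_at A' p' q'" "z' \<in> kuhn_params" "t' = barycentric A' p' q' z'"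
      unfolding realization_complex by fast
    show "t k = t' k"
    proof (cases "\<exists>B\<subseteq>{..<5}. k = set_encode B")
      case True
      then obtain B where B: "B \<subseteq> {..<5}" "k = set_encode B" by blast
      have "t k = depth (to_cube t) B"
        using depth_kuhn_point[OF T(1,2) B(1)] to_cube_barycentric[OF T(1)] T(3) B(2) by simp
      moreover have "t' k = depth (to_cube t') B"
        using depth_kuhn_point[OF T'(1,2) B(1)] to_cube_barycentric[OF T'(1)] T'(3) B(2) by simp
      ultimately show ?thesis using eq by simp
    next
      case False
      then have "k \<notin> set_encode ` Pow {..<5}" by blast
      then have "t k = 0" "t' k = 0"
        using triangle_atD[OF T(1)] triangle_atD[OF T'(1)]
        by (auto simp: T(3) T'(3) barycentric_def case_prod_unfold)
      then show ?thesis by simp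
    qed
  qed
qed

section \<open>The Euler characteristic\<close>

text \<open>
  The candidates for the smallest corner of a simplex that extends in the directions \<open>D\<close>. Simplices
  are counted by their smallest corner and the directions in which they extend: the edges of the
  cube and the diagonals of the squares for dimension one, ordered pairs for dimension two.
\<close>

definition bottoms :: "nat set \<Rightarrow> nat set set"
  where "bottoms D = {A. A \<subseteq> {..<5} - D}"

definition edge_dirs :: "nat set set"
  where "edge_dirs = {{0}, {1}, {2}, {3}, {4}, {0, 1}, {1, 2}, {2, 3}, {3, 4}, {4, 0}}"

lemma card_bottoms: "D \<subseteq> {..<5} \<Longrightarrow> card (bottoms D) = 2 ^ (5 - card D)"
  using finite_subset[of D "{..<5::nat}"]
  by (simp add: bottoms_def card_Pow[unfolded Pow_def] card_Diff_subset)

lemma finite_bottoms [simp]: "finite (bottoms D)"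
  by (simp add: bottoms_def)

lemma triangle_atI: "adj p q \<Longrightarrow> A \<in> bottoms {p, q} \<Longrightarrow> triangle_at A p q"
  by (simp add: triangle_at_def bottoms_def)

lemma vertex_simplices: "{\<sigma> \<in> simplices. card \<sigma> = 1} = (\<lambda>A. {A}) ` bottoms {}"
proof (intro equalityI subsetI)
  fix \<sigma> assume "\<sigma> \<in> {\<sigma> \<in> simplices. card \<sigma> = 1}"
  then show "\<sigma> \<in> (\<lambda>A. {A}) ` bottoms {}"
    using simplex_subset[of \<sigma>] by (auto simp: card_1_singleton_iff bottoms_def)
next
  fix \<sigma> :: "nat set set" assume "\<sigma> \<in> (\<lambda>A. {A}) ` bottoms {}"
  then obtain A where A: "A \<subseteq> {..<5}" "\<sigma> = {A}" by (auto simp: bottoms_def)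
  \<comment> \<open>\<open>A\<close> lies on the square through \<open>?B\<close> in the directions \<open>0\<close> and \<open>1\<close>\<close>
  let ?B = "A - {0, 1}"
  have T: "triangle_at ?B 0 1" "triangle_at ?B 1 0"
    using A by (auto simp: triangle_at_def adj_iff)
  have "A \<in> kuhn_triangle ?B 0 1 \<or> A \<in> kuhn_triangle ?B 1 0"
    by (auto simp: kuhn_triangle_def)
  with T show "\<sigma> \<in> {\<sigma> \<in> simplices. card \<sigma> = 1}"
    using A(2) unfolding simplices_def by auto
qed

lemma edge_dirs_iff: "D \<in> edge_dirs \<longleftrightarrow> (\<exists>p q. adj p q \<and> (D = {p} \<or> D = {p, q}))"
proof
  have adj: "adj 0 1" "adj 1 2" "adj 2 3" "adj 3 4" "adj 4 0" by (simp_all add: adj_iff)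
  assume "D \<in> edge_dirs"
  then consider "D = {0}" | "D = {1}" | "D = {2}" | "D = {3}" | "D = {4}"
    | "D = {0, 1}" | "D = {1, 2}" | "D = {2, 3}" | "D = {3, 4}" | "D = {4, 0}"
    by (auto simp: edge_dirs_def)
  then show "\<exists>p q. adj p q \<and> (D = {p} \<or> D = {p, q})"
    by cases (use adj in blast)+
next
  assume "\<exists>p q. adj p q \<and> (D = {p} \<or> D = {p, q})"
  then obtain p q where "adj p q" "D = {p} \<or> D = {p, q}" by blast
  then show "D \<in> edge_dirs"
    unfolding adj_iff edge_dirs_def by (elim insertE disjE) (simp_all add: doubleton_eq_iff)
qed

lemma two_of_three:
  assumes "\<sigma> \<subseteq> {a, b, c}" "card \<sigma> = 2"
  shows "\<sigma> = {a, b} \<or> \<sigma> = {a, c} \<or> \<sigma> = {b, c}"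
proof -
  obtain x y where "\<sigma> = {x, y}" "x \<noteq> y" using assms(2) by (auto simp: card_2_iff)
  then show ?thesis using assms(1) by (auto simp: doubleton_eq_iff)
qed

lemma edge_simplices:
  "{\<sigma> \<in> simplices. card \<sigma> = 2} = (\<lambda>(D, A). {A, A \<union> D}) ` Sigma edge_dirs bottoms"
proof (intro equalityI subsetI)
  fix \<sigma> assume "\<sigma> \<in> {\<sigma> \<in> simplices. card \<sigma> = 2}"
  then obtain A p q where T: "triangle_at A p q" and "\<sigma> \<subseteq> kuhn_triangle A p q" "card \<sigma> = 2"
    by (auto simp: simplices_def)
  then have cases: "\<sigma> = {A, insert p A} \<or> \<sigma> = {A, insert q (insert p A)} \<or> \<sigma> = {insert p A, insert q (insert p A)}"
    unfolding kuhn_triangle_def by (intro two_of_three)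
  note d = triangle_atD[OF T]
  have mem: "({p}, A) \<in> Sigma edge_dirs bottoms" "({p, q}, A) \<in> Sigma edge_dirs bottoms"
    "({q}, insert p A) \<in> Sigma edge_dirs bottoms"
    using d adj_sym[OF d(1)] by (auto simp: edge_dirs_iff bottoms_def)
  have union: "A \<union> {p} = insert p A" "A \<union> {p, q} = insert q (insert p A)"
    "insert p A \<union> {q} = insert q (insert p A)" by auto
  show "\<sigma> \<in> (\<lambda>(D, A). {A, A \<union> D}) ` Sigma edge_dirs bottoms"
    using cases imageI[OF mem(1), of "\<lambda>(D, A). {A, A \<union> D}"]
      imageI[OF mem(2), of "\<lambda>(D, A). {A, A \<union> D}"] imageI[OF mem(3), of "\<lambda>(D, A). {A, A \<union> D}"]
    unfolding prod.case union by (elim disjE) simp_all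
next
  fix \<sigma> :: "nat set set" assume "\<sigma> \<in> (\<lambda>(D, A). {A, A \<union> D}) ` Sigma edge_dirs bottoms"
  then obtain D A where D: "D \<in> edge_dirs" "A \<subseteq> {..<5} - D" and s: "\<sigma> = {A, A \<union> D}"
    by (auto simp: bottoms_def)
  obtain p q where pq: "adj p q" "D = {p} \<or> D = {p, q}" using D(1) by (auto simp: edge_dirs_iff)
  have "D \<noteq> {}" using pq by auto
  then have card: "card \<sigma> = 2" using D(2) by (auto simp: s card_2_iff)
  have "\<exists>A' p' q'. triangle_at A' p' q' \<and> \<sigma> \<subseteq> kuhn_triangle A' p' q'"
  proof (cases "D = {p, q} \<or> q \<notin> A")
    case True
    then have "triangle_at A p q" "\<sigma> \<subseteq> kuhn_triangle A p q"
      using pq D adj_less[OF pq(1)] by (auto simp: triangle_at_def kuhn_triangle_def s)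
    then show ?thesis by blast
  next
    case False
    then have "D = {p}" "q \<in> A" using pq by auto
    moreover have "insert q (A - {q}) = A" using \<open>q \<in> A\<close> by blast
    ultimately have "triangle_at (A - {q}) q p" "\<sigma> \<subseteq> kuhn_triangle (A - {q}) q p"
      using D adj_sym[OF pq(1)] by (auto simp: triangle_at_def kuhn_triangle_def s)
    then show ?thesis by blast
  qed
  then show "\<sigma> \<in> {\<sigma> \<in> simplices. card \<sigma> = 2}" using card by (auto simp: simplices_def s)
qed

lemma card_triangle:
  assumes "triangle_at A p q"
  shows "card (kuhn_triangle A p q) = 3"
proof -
  have "A \<noteq> insert p A" "A \<noteq> insert q (insert p A)" "insert p A \<noteq> insert q (insert p A)"
    using triangle_atD[OF assms] by auto
  then show ?thesis by (simp add: kuhn_triangle_def)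
qed

lemma triangle_simplices:
  "{\<sigma> \<in> simplices. card \<sigma> = 3} = (\<lambda>((p, q), A). kuhn_triangle A p q) ` Sigma pairs (\<lambda>(p, q). bottoms {p, q})"
proof (intro equalityI subsetI)
  fix \<sigma> assume "\<sigma> \<in> {\<sigma> \<in> simplices. card \<sigma> = 3}"
  then obtain A p q where T: "triangle_at A p q" and s: "\<sigma> \<subseteq> kuhn_triangle A p q" "card \<sigma> = 3"
    by (auto simp: simplices_def)
  have "\<sigma> = kuhn_triangle A p q"
    by (rule card_subset_eq) (use s card_triangle[OF T] in \<open>auto simp: kuhn_triangle_def\<close>)
  moreover have "((p, q), A) \<in> Sigma pairs (\<lambda>(p, q). bottoms {p, q})"
    using T by (auto simp: triangle_at_def bottoms_def)
  ultimately show "\<sigma> \<in> (\<lambda>((p, q), A). kuhn_triangle A p q) ` Sigma pairs (\<lambda>(p, q). bottoms {p, q})"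
    by force
next
  fix \<sigma> assume "\<sigma> \<in> (\<lambda>((p, q), A). kuhn_triangle A p q) ` Sigma pairs (\<lambda>(p, q). bottoms {p, q})"
  then obtain A p q where T: "triangle_at A p q" "\<sigma> = kuhn_triangle A p q"
    by (auto intro: triangle_atI)
  then show "\<sigma> \<in> {\<sigma> \<in> simplices. card \<sigma> = 3}"
    using card_triangle by (auto simp: simplices_def) (auto simp: kuhn_triangle_def)
qed

lemma triangle_inject:
  assumes "triangle_at A p q" "triangle_at A' p' q'" "kuhn_triangle A p q = kuhn_triangle A' p' q'"
  shows "A = A'" "p = p'" "q = q'"
proof -
  note d = triangle_atD[OF assms(1)] and d' = triangle_atD[OF assms(2)]
  have "\<Inter> (kuhn_triangle A p q) = A" "\<Inter> (kuhn_triangle A' p' q') = A'"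
    by (auto simp: kuhn_triangle_def)
  then show A: "A = A'" using assms(3) by simp
  have "\<Union> (kuhn_triangle A p q) = insert q (insert p A)" "\<Union> (kuhn_triangle A' p' q') = insert q' (insert p' A')"
    by (auto simp: kuhn_triangle_def)
  then have top: "insert q (insert p A) = insert q' (insert p' A)" using assms(3) A by simp
  have "insert p A \<in> kuhn_triangle A p q" by (simp add: kuhn_triangle_def)
  then have "insert p A = A \<or> insert p A = insert p' A \<or> insert p A = insert q' (insert p' A)"
    unfolding assms(3) by (simp add: kuhn_triangle_def A)
  moreover have "insert p A \<noteq> A" "insert p A \<noteq> insert q (insert p A)"
    using d(3,4,7) by auto
  ultimately have "insert p A = insert p' A" unfolding top by blast
  then show p: "p = p'" using d(3) by blast
  show "q = q'" using top d(4,7) unfolding p by blast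
qed

lemma card_edge_simplices: "card {\<sigma> \<in> simplices. card \<sigma> = 2} = 120"
proof -
  have "inj_on (\<lambda>(D, A). {A, A \<union> D}) (Sigma edge_dirs bottoms)"
  proof (rule inj_onI, clarify)
    fix D A D' A' :: "nat set"
    assume D: "D \<in> edge_dirs" "A \<in> bottoms D" "D' \<in> edge_dirs" "A' \<in> bottoms D'"
      and eq: "{A, A \<union> D} = {A', A' \<union> D'}"
    have "D \<noteq> {}" "D' \<noteq> {}" "A \<inter> D = {}" "A' \<inter> D' = {}"
      using D by (auto simp: edge_dirs_iff bottoms_def)
    then show "D = D' \<and> A = A'" using eq unfolding doubleton_eq_iff by blast
  qed
  then have "card {\<sigma> \<in> simplices. card \<sigma> = 2} = card (Sigma edge_dirs bottoms)"
    unfolding edge_simplices by (rule card_image)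
  also have "\<dots> = (\<Sum>D\<in>edge_dirs. card (bottoms D))"
    by (rule card_SigmaI) (auto simp: edge_dirs_def)
  also have "\<dots> = (\<Sum>D\<in>edge_dirs. 2 ^ (5 - card D))"
    by (rule sum.cong) (auto simp: edge_dirs_def card_bottoms)
  also have "\<dots> = 120"
    by (simp add: edge_dirs_def doubleton_eq_iff)
  finally show ?thesis .
qed

lemma card_triangle_simplices: "card {\<sigma> \<in> simplices. card \<sigma> = 3} = 80"
proof -
  have "inj_on (\<lambda>((p, q), A). kuhn_triangle A p q) (Sigma pairs (\<lambda>(p, q). bottoms {p, q}))"
    by (rule inj_onI) (auto dest: triangle_inject[OF triangle_atI triangle_atI])
  then have "card {\<sigma> \<in> simplices. card \<sigma> = 3} = card (Sigma pairs (\<lambda>(p, q). bottoms {p, q}))"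
    unfolding triangle_simplices by (rule card_image)
  also have "\<dots> = (\<Sum>(p, q)\<in>pairs. card (bottoms {p, q}))"
    by (subst card_SigmaI) (auto simp: adj_iff case_prod_unfold)
  also have "\<dots> = (\<Sum>(p, q)\<in>pairs. 8)"
  proof (rule sum.cong[OF HOL.refl], clarify)
    fix p q assume "adj p q"
    then show "card (bottoms {p, q}) = 8"
      using card_bottoms[of "{p, q}"] adj_less adj_irrefl by auto
  qed
  also have "pairs = {(0, 1), (1, 0), (1, 2), (2, 1), (2, 3), (3, 2), (3, 4), (4, 3), (4, 0), (0, 4)}"
    unfolding adj_iff by auto
  finally show ?thesis by simp
qed

text \<open>
  There are 32 corners, 80 + 40 edges and 80 triangles.
\<close>

lemma euler_characteristic: "(\<Sum>\<sigma>\<in>surface_complex. (- 1) ^ (card \<sigma> - 1)) = (- 8 :: int)"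
proof -
  have card_encode: "card (set_encode ` \<sigma>) = card \<sigma>" if "\<sigma> \<in> simplices" for \<sigma>
    by (rule card_image) (rule inj_on_subset[OF inj_on_encode simplex_subset[OF that]])
  have "inj_on ((`) set_encode) simplices"
    by (rule inj_on_subset[OF inj_on_image_Pow[OF inj_on_encode]]) (use simplex_subset in blast)
  then have "(\<Sum>\<sigma>\<in>surface_complex. (- 1) ^ (card \<sigma> - 1)) = (\<Sum>\<sigma>\<in>simplices. (- 1 :: int) ^ (card (set_encode ` \<sigma>) - 1))"
    unfolding surface_complex_def by (simp add: sum.reindex)
  also have "\<dots> = (\<Sum>\<sigma>\<in>simplices. (- 1) ^ (card \<sigma> - 1))"
    by (rule sum.cong) (simp_all add: card_encode)
  also have "\<dots> = (\<Sum>k\<in>{1, 2, 3}. \<Sum>\<sigma>\<in>{\<sigma> \<in> simplices. card \<sigma> = k}. (- 1) ^ (card \<sigma> - 1))"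
  proof (rule sum.group[symmetric])
    show "finite simplices" by (rule finite_simplices)
    show "card ` simplices \<subseteq> {1, 2, 3}"
    proof
      fix k assume "k \<in> card ` simplices"
      then obtain \<sigma> A p q where s: "k = card \<sigma>" "\<sigma> \<noteq> {}" "triangle_at A p q" "\<sigma> \<subseteq> kuhn_triangle A p q"
        by (auto simp: simplices_def)
      have fin: "finite (kuhn_triangle A p q)" by (simp add: kuhn_triangle_def)
      have "card \<sigma> \<le> 3" using card_mono[OF fin s(4)] card_triangle[OF s(3)] by simp
      moreover have "0 < card \<sigma>" using s(2) finite_subset[OF s(4) fin] by (simp add: card_gt_0_iff)
      ultimately show "k \<in> {1, 2, 3}" using s(1) by auto
    qed
  qed simp
  also have "\<dots> = int (card {\<sigma> \<in> simplices. card \<sigma> = 1}) - int (card {\<sigma> \<in> simplices. card \<sigma> = 2})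
      + int (card {\<sigma> \<in> simplices. card \<sigma> = 3})"
    by simp
  also have "card {\<sigma> \<in> simplices. card \<sigma> = 1} = 32"
    unfolding vertex_simplices by (subst card_image) (auto simp: card_bottoms)
  finally show ?thesis
    unfolding card_edge_simplices card_triangle_simplices by simp
qed

section \<open>Orientation\<close>

text \<open>
  In the plane, the squares around a corner follow the cyclic order of the directions; passing to a
  neighbouring corner is a reflection and reverses this order. So whether the cyclic orientation of
  a triangle ascends depends on the order of its two directions and on the parity of its smallest
  corner.
\<close>

definition positively_oriented :: "nat set \<Rightarrow> nat \<Rightarrow> nat \<Rightarrow> bool"
  where "positively_oriented A p q \<longleftrightarrow> (q = Suc p mod 5) = even (card A)"

definition ascending :: "nat set \<Rightarrow> nat \<Rightarrow> nat \<Rightarrow> (nat set \<times> nat set) set"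
  where "ascending A p q =
    {(A, insert p A), (insert p A, insert q (insert p A)), (insert q (insert p A), A)}"

definition oriented :: "nat set \<Rightarrow> nat \<Rightarrow> nat \<Rightarrow> (nat set \<times> nat set) set"
  where "oriented A p q = (if positively_oriented A p q then ascending A p q else (ascending A p q)\<inverse>)"

lemma adj_next_cases:
  assumes "adj p q"
  shows "(q = Suc p mod 5) \<noteq> (p = Suc q mod 5)"
  using assms unfolding adj_iff by (elim insertE) simp_all

lemma adj_unique:
  assumes "adj p q" "adj p q'" "(q = Suc p mod 5) = (q' = Suc p mod 5)"
  shows "q = q'"
proof (cases "q = Suc p mod 5")
  case True
  with assms(3) show ?thesis by simp
next
  case False
  with assms have "p = Suc q mod 5" "p = Suc q' mod 5" "q < 5" "q' < 5"
    unfolding adj_def by blast+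
  then show ?thesis by (auto simp: mod_Suc split: if_splits)
qed

text \<open>
  The two short sides of a triangle increase the cardinality by one, and the long side decreases it
  by two. This limits how a directed side of one triangle can be a side of another one.
\<close>

lemma shared_cycle_edge:
  assumes "card b = Suc (card a)" "card c = card a + 2" "card b' = Suc (card a')" "card c' = card a' + 2"
    and "e \<in> {(a, b), (b, c), (c, a)}" "e \<in> {(a', b'), (b', c'), (c', a')}"
  shows "a = a' \<and> b = b' \<or> a = b' \<and> b = c' \<or> a' = b \<and> b' = c \<or> b = b' \<and> c = c' \<or> a = a' \<and> c = c'"
proof -
  obtain x y where e: "e = (x, y)" by force
  have "x = a \<and> y = b \<or> x = b \<and> y = c \<or> x = c \<and> y = a"
    "x = a' \<and> y = b' \<or> x = b' \<and> y = c' \<or> x = c' \<and> y = a'"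
    using assms(5,6) by (simp_all add: e)
  then show ?thesis using assms(1-4) by (elim disjE conjE) simp_all
qed

text \<open>
  An edge of the cube in direction \<open>p\<close> lies in two triangles, whose other directions are the
  successor and the predecessor of \<open>p\<close>. If it is a lower side of both or an upper side of both, then
  the orders of the directions give them opposite signs; if it is a lower side of one and an upper
  side of the other, then the directions are listed in the same sense but the parities of the smallest
  corners differ. A diagonal lies in the two halves of a square, which list its directions in
  opposite orders.
\<close>

lemma ascending_disjoint:
  assumes T: "triangle_at A p q" "triangle_at A' p' q'"
    and pos: "positively_oriented A p q = positively_oriented A' p' q'"
    and e: "e \<in> ascending A p q" "e \<in> ascending A' p' q'"
  shows "A = A' \<and> p = p' \<and> q = q'"
proof -
  note d = triangle_atD[OF T(1)] and d' = triangle_atD[OF T(2)]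
  have parity: "(q = Suc p mod 5) = (q' = Suc p' mod 5)" if "even (card A) = even (card A')"
    using pos that by (auto simp: positively_oriented_def)
  \<comment> \<open>the shared edge cannot be the lower short side of one triangle and the upper one of the other\<close>
  have mixed: False if "A = insert p' A'" "p = q'" "adj p q" "adj p' q'" "q \<notin> A" "p' \<notin> A'" "finite A'"
    "positively_oriented A p q = positively_oriented A' p' q'" for A A' :: "nat set" and p q p' q'
  proof -
    have "card A = Suc (card A')" using that by simp
    then have "(q = Suc p mod 5) \<noteq> (p = Suc p' mod 5)"
      using that by (auto simp: positively_oriented_def)
    moreover have p': "adj p' p" using that(2,4) by simp
    ultimately have "(q = Suc p mod 5) = (p' = Suc p mod 5)"
      using adj_next_cases[OF p'] by argo
    then have "q = p'" by (rule adj_unique[OF that(3) adj_sym[OF p']])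
    then show False using that by blast
  qed
  consider "A = A'" "insert p A = insert p' A'"
    | "A = insert p' A'" "insert p A = insert q' (insert p' A')"
    | "A' = insert p A" "insert p' A' = insert q (insert p A)"
    | "insert p A = insert p' A'" "insert q (insert p A) = insert q' (insert p' A')"
    | "A = A'" "insert q (insert p A) = insert q' (insert p' A')"
  proof -
    have "card (insert p A) = Suc (card A)" "card (insert q (insert p A)) = card A + 2"
      "card (insert p' A') = Suc (card A')" "card (insert q' (insert p' A')) = card A' + 2"
      using d d' by auto
    from shared_cycle_edge[OF this e[unfolded ascending_def]] that show ?thesis by blast
  qed
  then show ?thesis
  proof cases
    case 1
    then have "p = p'" using d d' by blast
    moreover have "q = q'" using adj_unique[of p q q'] parity d d' 1 \<open>p = p'\<close> by simp
    ultimately show ?thesis using 1 by simp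
  next
    case 2
    then have "p = q'" using d d' by blast
    from mixed[OF 2(1) this d(1) d'(1) d(4) d'(3) d'(8) pos] show ?thesis ..
  next
    case 3
    then have "p' = q" using d d' by blast
    from mixed[OF 3(1) this d'(1) d(1) d'(4) d(3) d(8) pos[symmetric]] show ?thesis ..
  next
    case 4
    have "q \<notin> insert p A" using d(4,7) by simp
    then have "q = q'" using 4(2) unfolding 4(1) by blast
    have "card A = card A'"
      using arg_cong[OF 4(1), of card] d d' by simp
    then have "(q = Suc p mod 5) = (q' = Suc p' mod 5)" using parity by simp
    moreover have p': "adj p' q" using d'(1) \<open>q = q'\<close> by simp
    ultimately have "(p = Suc q mod 5) = (p' = Suc q mod 5)"
      using adj_next_cases[OF d(1)] adj_next_cases[OF p'] \<open>q = q'\<close> by auto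
    then have "p = p'" by (rule adj_unique[OF adj_sym[OF d(1)] adj_sym[OF p']])
    moreover have "A = A'" using 4(1) insert_ident[OF d(3), of A'] d'(3) \<open>p = p'\<close> by simp
    ultimately show ?thesis using \<open>q = q'\<close> by simp
  next
    case 5
    then have "insert q (insert p A) - A = {p, q}" "insert q (insert p A) - A = {p', q'}"
      using d(3,4) d'(3,4) by auto
    then have "p = p' \<and> q = q' \<or> p = q' \<and> q = p'" by (auto simp: doubleton_eq_iff)
    then show ?thesis using 5 parity adj_next_cases[OF d(1)] by auto
  qed
qed

lemma ascending_card:
  assumes "triangle_at A p q" "(x, y) \<in> ascending A p q"
  shows "card y = Suc (card x) \<or> card x = card y + 2"
  using assms(2) triangle_atD[OF assms(1)] by (auto simp: ascending_def)

lemma oriented_disjoint: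
  assumes T: "triangle_at A p q" "triangle_at A' p' q'"
    and e: "e \<in> oriented A p q" "e \<in> oriented A' p' q'"
  shows "A = A' \<and> p = p' \<and> q = q'"
proof (cases "positively_oriented A p q = positively_oriented A' p' q'")
  case same: True
  obtain x y where xy: "e = (x, y)" by force
  show ?thesis
  proof (cases "positively_oriented A p q")
    case True
    with same e show ?thesis by (intro ascending_disjoint[OF T, of e]) (auto simp: oriented_def)
  next
    case False
    with same e show ?thesis
      by (intro ascending_disjoint[OF T, of "(y, x)"]) (auto simp: oriented_def xy)
  qed
next
  case False
  obtain x y where xy: "e = (x, y)" by force
  have "(x, y) \<in> ascending A p q \<and> (y, x) \<in> ascending A' p' q' \<or>
      (y, x) \<in> ascending A p q \<and> (x, y) \<in> ascending A' p' q'"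
    using False e by (auto simp: oriented_def xy split: if_splits)
  then show ?thesis
    using ascending_card[OF T(1)] ascending_card[OF T(2)] by fastforce
qed

lemma coherently_orientable_complex: "coherently_orientable surface_complex"
proof -
  define code where "code A p q = set_encode ` kuhn_triangle A p q" for A p q
  define D where "D \<sigma> = (\<Union>(A, p, q)\<in>{(A, p, q). triangle_at A p q \<and> \<sigma> = code A p q}.
      map_prod set_encode set_encode ` oriented A p q)" for \<sigma>
  have code_inject: "A = A' \<and> p = p' \<and> q = q'"
    if "triangle_at A p q" "triangle_at A' p' q'" "code A p q = code A' p' q'" for A p q A' p' q'
  proof -
    have sub: "kuhn_triangle A p q \<subseteq> Pow {..<5}" "kuhn_triangle A' p' q' \<subseteq> Pow {..<5}"
      using triangle_atD[OF that(1)] triangle_atD[OF that(2)] by (auto simp: kuhn_triangle_def)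
    have "kuhn_triangle A p q = kuhn_triangle A' p' q'"
      using that(3) inj_on_image_eq_iff[OF inj_on_encode sub] by (simp add: code_def)
    then show ?thesis using triangle_inject[OF that(1,2)] by blast
  qed
  have D: "D (code A p q) = map_prod set_encode set_encode ` oriented A p q" if "triangle_at A p q" for A p q
    using that code_inject unfolding D_def by blast
  have ex: "\<exists>A p q. triangle_at A p q \<and> \<sigma> = code A p q" if "\<sigma> \<in> surface_complex" "card \<sigma> = 3" for \<sigma>
  proof -
    obtain \<rho> where r: "\<rho> \<in> simplices" "\<sigma> = set_encode ` \<rho>" using \<open>\<sigma> \<in> surface_complex\<close> by (auto simp: surface_complex_def)
    have "card \<rho> = 3"
      using card_image[OF inj_on_subset[OF inj_on_encode simplex_subset[OF r(1)]]] r(2) \<open>card \<sigma> = 3\<close> by simp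
    then have "\<rho> \<in> {\<sigma> \<in> simplices. card \<sigma> = 3}" using r(1) by simp
    then obtain A p q where "adj p q" "A \<in> bottoms {p, q}" "\<rho> = kuhn_triangle A p q"
      unfolding triangle_simplices by auto
    then show ?thesis using triangle_atI r(2) unfolding code_def by blast
  qed
  show ?thesis
    unfolding coherently_orientable_def
  proof (intro exI[of _ D] conjI ballI impI)
    fix \<sigma> assume "\<sigma> \<in> surface_complex" "card \<sigma> = 3"
    then obtain A p q where T: "triangle_at A p q" "\<sigma> = code A p q" using ex by blast
    let ?a = "set_encode A" and ?b = "set_encode (insert p A)" and ?c = "set_encode (insert q (insert p A))"
    have s: "\<sigma> = {?a, ?b, ?c}" "\<sigma> = {?b, ?a, ?c}" using T by (auto simp: code_def kuhn_triangle_def)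
    show "\<exists>a b c. \<sigma> = {a, b, c} \<and> D \<sigma> = {(a, b), (b, c), (c, a)}"
    proof (cases "positively_oriented A p q")
      case True
      then have "D \<sigma> = {(?a, ?b), (?b, ?c), (?c, ?a)}"
        using D[OF T(1)] T(2) by (simp add: oriented_def ascending_def)
      then show ?thesis using s(1) by blast
    next
      case False
      then have "D \<sigma> = {(?b, ?a), (?a, ?c), (?c, ?b)}"
        using D[OF T(1)] T(2) by (auto simp: oriented_def ascending_def)
      then show ?thesis using s(2) by blast
    qed
  next
    fix \<sigma> \<tau> assume st: "\<sigma> \<in> surface_complex" "\<tau> \<in> surface_complex" "card \<sigma> = 3 \<and> card \<tau> = 3 \<and> \<sigma> \<noteq> \<tau>"
    obtain A p q where T: "triangle_at A p q" "\<sigma> = code A p q" using ex st by blast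
    obtain A' p' q' where T': "triangle_at A' p' q'" "\<tau> = code A' p' q'" using ex st by blast
    have sub: "oriented A p q \<subseteq> Pow {..<5} \<times> Pow {..<5}" if "triangle_at A p q" for A p q
      using triangle_atD[OF that] by (auto simp: oriented_def ascending_def)
    have inj: "inj_on (map_prod set_encode set_encode) (Pow {..<5} \<times> Pow {..<5})"
      using map_prod_inj_on[OF inj_on_encode inj_on_encode] .
    have "oriented A p q \<inter> oriented A' p' q' = {}"
      using oriented_disjoint[OF T(1) T'(1)] st T T' by blast
    then show "D \<sigma> \<inter> D \<tau> = {}"
      using inj_on_image_Int[OF inj sub[OF T(1)] sub[OF T'(1)]] D[OF T(1)] D[OF T'(1)] T(2) T'(2) by simp
  qed
qed

section \<open>The surface subgroup\<close>

text \<open>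
  Every point is joined to a corner inside a star, and corners are joined by edge paths.
\<close>

lemma path_connected_cube_surface: "path_connected cube_surface"
proof -
  have reach: "\<exists>g. path g \<and> path_image g \<subseteq> cube_surface \<and> pathstart g = x \<and> pathfinish g = corner {}"
    if "x \<in> cube_surface" for x
  proof -
    obtain v where v: "v \<subseteq> {..<5}" "x \<in> corner_star v" using in_some_star \<open>x \<in> cube_surface\<close> by blast
    have segment: "path_image (segment x (corner v)) \<subseteq> cube_surface"
      using segment_to_corner_in_star[OF v(2,1)] star_subset by blast
    have e: "path_image (epath v (word_between v {})) \<subseteq> cube_surface"
      by (intro path_image_epath v(1)) (auto simp: set_word_between)
    show ?thesis
      using segment e fold_flip_word_between[OF v(1), of "{}"]
      by (intro exI[of _ "segment x (corner v) +++ epath v (word_between v {})"]) (auto simp: path_image_join)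
  qed
  show ?thesis
    unfolding path_connected_def
  proof (intro ballI)
    fix x y assume "x \<in> cube_surface" "y \<in> cube_surface"
    then obtain g h where "path g" "path_image g \<subseteq> cube_surface" "pathstart g = x" "pathfinish g = corner {}"
      "path h" "path_image h \<subseteq> cube_surface" "pathstart h = y" "pathfinish h = corner {}"
      using reach by metis
    then show "\<exists>g. path g \<and> path_image g \<subseteq> cube_surface \<and> pathstart g = x \<and> pathfinish g = y"
      by (intro exI[of _ "g +++ reversepath h"]) (auto simp: path_image_join)
  qed
qed

lemma closed_surface_cube_surface: "closed_surface cube_surface"
  unfolding closed_surface_def
proof (intro conjI ballI)
  show "cube_surface \<noteq> {}" using corner_in_surface[of "{}"] by auto
  show "compact cube_surface"
    using compact_realization homeomorphic_compactness[OF realization_homeomorphic] by blast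
  show "connected cube_surface"
    by (rule path_connected_imp_connected[OF path_connected_cube_surface])
  fix x assume "x \<in> cube_surface"
  then obtain v where v: "v \<subseteq> {..<5}" "x \<in> corner_star v" by (rule in_some_star)
  have "corner_star v homeomorphic (UNIV :: (real \<times> real) set)"
    using star_homeomorphic_prod[OF v(1)] unfolding homeomorphic_def by blast
  moreover have "(UNIV :: (real \<times> real) set) homeomorphic (UNIV :: (real ^ 2) set)"
    by (simp add: homeomorphic_UNIV_UNIV)
  ultimately have "corner_star v homeomorphic (UNIV :: (real ^ 2) set)"
    by (rule homeomorphic_trans)
  then show "\<exists>U. openin (top_of_set cube_surface) U \<and> x \<in> U \<and> U homeomorphic (UNIV :: (real ^ 2) set)"
    using openin_star v(2) by blast
qed

lemma triangulates_cube_surface: "triangulates surface_complex cube_surface"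
  using complex_simplicial realization_homeomorphic by (simp add: triangulates_def)

abbreviation "base \<equiv> corner {}"

lemma loops_atD:
  assumes "p \<in> loops_at cube_surface base"
  shows "path p" "path_image p \<subseteq> cube_surface" "p 0 = base" "p 1 = base"
  using assms by (auto simp: loops_at_def pathstart_def pathfinish_def)

lemma corner_inject: "corner u = corner v \<longleftrightarrow> u = v"
  by (auto simp: corner_def fun_eq_iff split: if_splits)

lemma traces_loop:
  assumes "p \<in> loops_at cube_surface base" "traces p w"
  shows "homotopic_paths cube_surface p (epath {} w)" "fold flip w {} = {}"
proof -
  show *: "homotopic_paths cube_surface p (epath {} w)"
    using traces_homotopic_epath[OF assms(2) loops_atD[OF assms(1)]] by simp
  show "fold flip w {} = {}"
    using homotopic_paths_imp_pathfinish[OF *] loops_atD(4)[OF assms(1)]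
    by (simp add: pathfinish_def[of p] corner_inject)
qed

definition raag_class :: "nat \<Rightarrow> nat list \<Rightarrow> nat word set"
  where "raag_class n w = pres_class {..<n} (anticycle_relators n) (raag_word n {} w)"

text \<open>
  The word traced by a loop is only determined up to \<open>\<doteq>\<close>; the choice is harmless after passing to
  the Artin group.
\<close>

definition holonomy :: "nat \<Rightarrow> (real \<Rightarrow> nat \<Rightarrow> real) set \<Rightarrow> nat word set"
  where "holonomy n c =
    raag_class n (SOME w. \<exists>p\<in>loops_at cube_surface base. c = path_class cube_surface p \<and> traces p w)"

lemma holonomy_path_class:
  assumes "n \<ge> 5" "p \<in> loops_at cube_surface base" "traces p w"
  shows "holonomy n (path_class cube_surface p) = raag_class n w"
proof -
  let ?P = "\<lambda>w. \<exists>q\<in>loops_at cube_surface base. path_class cube_surface p = path_class cube_surface q \<and> traces q w"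
  have "?P (SOME w. ?P w)" by (rule someI[of ?P w]) (use assms in blast)
  then obtain q where q: "path_class cube_surface p = path_class cube_surface q" "traces q (SOME w. ?P w)"
    by blast
  then have "homotopic_paths cube_surface p q" using path_class_eq_iff[OF assms(2)] by blast
  then have "w \<doteq> (SOME w. ?P w)"
    using loops_atD(3,4)[OF assms(2)] assms(3) q(2) by (intro traces_homotopic) auto
  then show ?thesis
    unfolding holonomy_def raag_class_def
    using raag_word_weq[OF assms(1)] by (simp add: pres_class_eq_iff pres_eq.sym)
qed

lemma path_class_loopE:
  assumes "c \<in> carrier (fundamental_group cube_surface base)"
  obtains p w where "p \<in> loops_at cube_surface base" "c = path_class cube_surface p" "traces p w"
proof -
  obtain p where p: "p \<in> loops_at cube_surface base" "c = path_class cube_surface p"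
    using assms by (auto simp: fundamental_group_def)
  obtain w where "traces p w" using traces_exists loops_atD(1,2)[OF p(1)] by blast
  then show ?thesis using that p by blast
qed

lemma raag_eq: "raag {..<n} (complement_edges {..<n} (cycle_edges n)) = presented_group {..<n} (anticycle_relators n)"
  by (simp add: raag_def)

lemma holonomy_hom:
  assumes "n \<ge> 5"
  shows "holonomy n \<in> hom (fundamental_group cube_surface base) (presented_group {..<n} (anticycle_relators n))"
proof (rule homI)
  let ?F = "fundamental_group cube_surface base" and ?G = "presented_group {..<n} (anticycle_relators n)"
  show "holonomy n c \<in> carrier ?G" if c: "c \<in> carrier ?F" for c
  proof -
    obtain p w where "p \<in> loops_at cube_surface base" "c = path_class cube_surface p" "traces p w"
      using path_class_loopE[OF c] by blast
    then show ?thesis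
      using holonomy_path_class[OF assms] raag_word_words_over[OF assms]
      by (simp add: raag_class_def presented_group_def)
  qed
  show "holonomy n (c \<otimes>\<^bsub>?F\<^esub> d) = holonomy n c \<otimes>\<^bsub>?G\<^esub> holonomy n d"
    if c: "c \<in> carrier ?F" and d: "d \<in> carrier ?F" for c d
  proof -
    obtain p w where p: "p \<in> loops_at cube_surface base" "c = path_class cube_surface p" "traces p w"
      using path_class_loopE[OF c] by blast
    obtain q w' where q: "q \<in> loops_at cube_surface base" "d = path_class cube_surface q" "traces q w'"
      using path_class_loopE[OF d] by blast
    have "traces (p +++ q) (w @ w')"
      using p(1) q(1) by (intro traces_join[OF p(3) q(3), of "{}"]) (auto simp: loops_at_def)
    then have "holonomy n (c \<otimes>\<^bsub>?F\<^esub> d) = raag_class n (w @ w')"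
      using holonomy_path_class[OF assms loops_at_join[OF p(1) q(1)]]
      by (simp add: p(2) q(2) fundamental_group_mult[OF p(1) q(1)])
    also have "\<dots> = raag_class n w \<otimes>\<^bsub>?G\<^esub> raag_class n w'"
      by (simp add: raag_class_def raag_word_append traces_loop(2)[OF p(1,3)] presented_group_mult)
    finally show ?thesis
      using holonomy_path_class[OF assms p(1,3)] holonomy_path_class[OF assms q(1,3)] p(2) q(2) by simp
  qed
qed

text \<open>
  If two loops have the same image in the Artin group, then the words they trace are equivalent, so
  the corresponding edge paths, and with them the loops, are homotopic.
\<close>

lemma holonomy_inj:
  assumes "n \<ge> 5"
  shows "inj_on (holonomy n) (carrier (fundamental_group cube_surface base))"
proof (rule inj_onI)
  let ?F = "fundamental_group cube_surface base"
  fix c d assume c: "c \<in> carrier ?F" and d: "d \<in> carrier ?F" and eq: "holonomy n c = holonomy n d"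
  obtain p w where p: "p \<in> loops_at cube_surface base" "c = path_class cube_surface p" "traces p w"
    using path_class_loopE[OF c] by blast
  obtain q w' where q: "q \<in> loops_at cube_surface base" "d = path_class cube_surface q" "traces q w'"
    using path_class_loopE[OF d] by blast
  have "raag_class n w = raag_class n w'"
    using eq holonomy_path_class[OF assms p(1,3)] holonomy_path_class[OF assms q(1,3)] p(2) q(2) by simp
  then have "w \<doteq> w'"
    unfolding raag_class_def pres_class_eq_iff
    using raag_word_faithful[OF assms traces_letters[OF p(3)] traces_letters[OF q(3)]] by blast
  then have "homotopic_paths cube_surface (epath {} w) (epath {} w')"
    using traces_letters[OF p(3)] by (intro epath_weq) auto
  then have "homotopic_paths cube_surface p q"
    using traces_loop(1)[OF p(1,3)] traces_loop(1)[OF q(1,3)]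
    by (meson homotopic_paths_sym homotopic_paths_trans)
  then show "c = d" using path_class_eq_iff[OF p(1)] p(2) q(2) by blast
qed

theorem theorem1:
  fixes n :: nat
  assumes "n \<ge> 5"
  shows "\<exists>H. subgroup H (raag {..<n} (complement_edges {..<n} (cycle_edges n))) \<and>
    hyperbolic_surface_group
      ((raag {..<n} (complement_edges {..<n} (cycle_edges n)))\<lparr>carrier := H\<rparr>)"
proof -
  let ?F = "fundamental_group cube_surface base" and ?G = "presented_group {..<n} (anticycle_relators n)"
  let ?H = "holonomy n ` carrier ?F"
  have base: "base \<in> cube_surface" by (simp add: corner_in_surface)
  have F: "group ?F" by (rule group_fundamental_group[OF base])
  interpret group_hom ?F ?G "holonomy n"
    by (intro group_hom.intro group_hom_axioms.intro F group_presented_group holonomy_hom assms)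
  have "holonomy n \<in> iso ?F (?G\<lparr>carrier := ?H\<rparr>)"
    using holonomy_hom[OF assms] holonomy_inj[OF assms]
    by (auto simp: iso_def hom_def bij_betw_def)
  then have "?F \<cong> ?G\<lparr>carrier := ?H\<rparr>" by (auto simp: is_iso_def)
  then have iso: "?G\<lparr>carrier := ?H\<rparr> \<cong> ?F" by (rule group.iso_sym[OF F])
  have "orientable_surface cube_surface"
    unfolding orientable_surface_def
    using closed_surface_cube_surface triangulates_cube_surface coherently_orientable_complex by blast
  moreover have "has_euler_characteristic cube_surface (- 8)"
    unfolding has_euler_characteristic_def
    using triangulates_cube_surface euler_characteristic by metis
  ultimately have "hyperbolic_surface_group (?G\<lparr>carrier := ?H\<rparr>)"
    unfolding hyperbolic_surface_group_def using base iso
    by (intro exI[of _ cube_surface] exI[of _ base] exI[of _ "- 8"]) simp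
  then show ?thesis unfolding raag_eq using img_is_subgroup by blast
qed

end
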